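(* Let $B \subset \mathbb{R}^{2n}$ be an open set, and equip $X = B \times T^{2n}$ with a product hyperkähler structure $(g,(I,J,K))$ such that $B \times \{\mathrm{pt}\} \subset X$ is a complex Lagrangian with respect to $I$. Let $h \colon B \to T^{2n}$ be a smooth function, let $S_h = \{(x,h(x)) : x \in B\} \subset X$ be its graph, and let $\nabla^h$ be the real Fourier-Mukai transform of $S_h$, a connection on the trivial complex line bundle $\underline{\mathbb{C}} \to X^* = B \times (T^{2n})^*$. Then $$S_h \text{ is complex Lagrangian with respect to } I \iff \nabla^h \text{ is an } \mathrm{Sp}(n)\text{-instanton.}$$
   Context: Torus conventions: $T^{m} = \mathbb{R}^m/(2\pi\mathbb{Z})^m$ and $(T^m)^* $ is the dual torus, with its standard dual coordinates. Product hyperkähler structure: on $B\subset\mathbb{R}^{2n}$ use coordinates $x^1,\dots,x^n,y^1,\dots,y^n$ and on $T^{2n}$ use coordinates $u^1,\dots,u^n,v^1,\dots,v^n$. The metric is $g = \sum_a (dx^a)^2+(dy^a)^2+(du^a)^2+(dv^a)^2$, and the orthogonal complex structures are determined by $I\partial_{x^a} = \partial_{y^a}$, $I\partial_{u^a} = \partial_{v^a}$; $J\partial_{x^a}=\partial_{u^a}$, $J\partial_{v^a}=\partial_{y^a}$; $K\partial_{x^a}=\partial_{v^a}$, $K\partial_{y^a}=\partial_{u^a}$ (so $IJ=K$). The forms $\omega_L = g(L\cdot,\cdot)$, $L \in\{I,J,K\}$, are $\omega_I=\sum_a dx^a\wedge dy^a+du^a\wedge dv^a$, $\omega_J=\sum_a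 dx^a\wedge du^a+dv^a\wedge dy^a$, $\omega_K=\sum_a dx^a\wedge dv^a+dy^a\wedge du^a$. The space $X^* = B\times (T^{2n})^*$ carries the hyperkähler structure given by the same formulas, where $u^a,v^a$ now denote the corresponding standard coordinates on $(T^{2n})^*$. Complex Lagrangian: a $2n$-dimensional submanifold $L$ of a hyperkähler $4n$-manifold is complex Lagrangian with respect to $I$ if it is complex with respect to $I$ and Lagrangian with respect to both $\omega_J$ and $\omega_K$ (any two of these three conditions imply the third). Real Fourier-Mukai transform: writing $h=(f^1,\dots,f^n,g^1,\dots,g^n)$ in the coordinates $(u,v)$, the transform of $S_h$ is $$\nabla^h = d + i\sum_{a=1}^n \left(f^a\,du^a + g^a\,dv^a\right)$$ on $\underline{\mathbb{C}}\to X^*$ ($f^a,g^a$ being defined locally up to constants in $2\pi\mathbb{Z}$). Its curvature is the well-defined $i\mathbb{R}$-valued 2-form $i\sum_a (df^a\wedge du^a+dg^a\wedge dv^a)$ on $X^*$. $\mathrm{Sp}(n)$-instanton: a (Hermitian) connection $A$ on a Hermitian bundle over a hyperkähler $4n$-manifold is an $\mathrm{Sp}(n)$-instanton if it is primitive Hermitian Yang-Mills with respect to each $L\in\{I,J,K\}$: $(F_A)^{0,2}_L=0$ and $F_A\wedge\omega_L^{2n-1}=0$, where $(\cdot)^{0,2}_L$ is the type $(0,2)$ component with respect to $L$. *)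

theory Defs
  imports "HOL-Analysis.Analysis" "HOL-Combinatorics.Permutations"
begin

section \<open>Smooth maps between open subsets of normed spaces\<close>

primrec Ck_on :: "nat \<Rightarrow> 'a::real_normed_vector set \<Rightarrow> ('a \<Rightarrow> 'b::real_normed_vector) \<Rightarrow> bool"
  where
    "Ck_on 0 S f \<longleftrightarrow> continuous_on S f"
  | "Ck_on (Suc k) S f \<longleftrightarrow>
       (\<forall>x\<in>S. f differentiable (at x)) \<and>
       (\<forall>v. Ck_on k S (\<lambda>x. frechet_derivative f (at x) v))"

text \<open>Only meaningful for open \<open>S\<close>.\<close>

definition smooth_on :: "'a::real_normed_vector set \<Rightarrow> ('a \<Rightarrow> 'b::real_normed_vector) \<Rightarrow> bool"
  where "smooth_on S f \<longleftrightarrow> (\<forall>k. Ck_on k S f)"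

lemma smooth_on_const: "smooth_on S (\<lambda>_. c)"
proof -
  have "Ck_on k S (\<lambda>_. c)" for k and c :: 'b
    by (induction k arbitrary: c) auto
  then show ?thesis by (simp add: smooth_on_def)
qed

lemma smooth_on_affine:
  assumes "bounded_linear f"
  shows "smooth_on S (\<lambda>x. c + f x)"
proof -
  have D: "((\<lambda>x. c + f x) has_derivative f) (at x)" for x
    using bounded_linear_imp_has_derivative[OF assms] by (auto intro!: derivative_eq_intros)
  have F: "frechet_derivative (\<lambda>x. c + f x) (at x) = f" for x
    using frechet_derivative_at[OF D[of x]] by simp
  have "Ck_on k S (\<lambda>x. c + f x)" for k
  proof (cases k)
    case 0
    then show ?thesis
      using assms by (simp add: continuous_on_add linear_continuous_on)
  next
    case (Suc j)
    have "Ck_on j S (\<lambda>x. f v)" for v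
      using smooth_on_const[of S "f v"] by (simp add: smooth_on_def)
    moreover have "(\<lambda>x. c + f x) differentiable (at x)" for x
      using D unfolding differentiable_def by blast
    ultimately show ?thesis
      using Suc by (simp add: F)
  qed
  then show ?thesis by (simp add: smooth_on_def)
qed


section \<open>The torus and its dual\<close>

definition period_lattice :: "(real^'m::finite) set"
  where "period_lattice = {k. \<forall>a. \<exists>j::int. k $ a = 2 * pi * of_int j}"

text \<open>
  The dual torus of \<open>V / \<Lambda>\<close> is \<open>V\<^sup>* / \<Lambda>\<^sup>*\<close>, where \<open>\<Lambda>\<^sup>*\<close> consists of the covectors that
  take values in \<open>2\<pi>\<int>\<close> on \<open>\<Lambda>\<close>. Covectors are identified with vectors by the standard inner
  product. For \<open>\<Lambda> = (2\<pi>\<int>)\<^sup>m\<close> this makes \<open>\<Lambda>\<^sup>* = \<int>\<^sup>m\<close>, so that the standard dual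
  coordinates have period 1, and \<open>exp (i k u)\<close> with \<open>k \<in> (2\<pi>\<int>)\<^sup>m\<close> is well defined on the
  dual torus.
\<close>

definition dual_lattice :: "(real^'m::finite) set"
  where "dual_lattice = {\<xi>. \<forall>k\<in>period_lattice. \<exists>j::int. \<xi> \<bullet> k = 2 * pi * of_int j}"

lemma dual_lattice_iff:
  fixes \<xi> :: "real^'m::finite"
  shows "\<xi> \<in> dual_lattice \<longleftrightarrow> (\<forall>a. \<xi> $ a \<in> \<int>)"
proof
  assume \<xi>: "\<xi> \<in> dual_lattice"
  show "\<forall>a. \<xi> $ a \<in> \<int>"
  proof
    fix a :: 'm
    have "axis a (2 * pi) \<in> period_lattice"
      unfolding period_lattice_def axis_def by (auto intro: exI[of _ 1] exI[of _ 0])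
    then obtain j :: int where "\<xi> \<bullet> axis a (2 * pi) = 2 * pi * of_int j"
      using \<xi> unfolding dual_lattice_def by blast
    then have "\<xi> $ a = of_int j"
      by (simp add: inner_axis)
    then show "\<xi> $ a \<in> \<int>" by simp
  qed
next
  assume \<xi>: "\<forall>a. \<xi> $ a \<in> \<int>"
  have "\<exists>j::int. \<xi> \<bullet> k = 2 * pi * of_int j" if k: "k \<in> period_lattice" for k :: "real^'m"
  proof -
    obtain f :: "_ \<Rightarrow> int" where f: "\<And>a. k $ a = 2 * pi * of_int (f a)"
      using k unfolding period_lattice_def mem_Collect_eq by metis
    define g where "g a = \<lfloor>\<xi> $ a\<rfloor>" for a
    have g: "\<xi> $ a = of_int (g a)" for a
      using \<xi> unfolding g_def by (metis Ints_cases floor_of_int)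
    have "\<xi> \<bullet> k = 2 * pi * of_int (\<Sum>a\<in>UNIV. g a * f a)"
      by (simp add: inner_vec_def f g sum_distrib_left mult_ac)
    then show ?thesis by blast
  qed
  then show "\<xi> \<in> dual_lattice"
    unfolding dual_lattice_def by blast
qed

lemma period_lattice_iff: "k \<in> period_lattice \<longleftrightarrow> (\<forall>a. k $ a / (2 * pi) \<in> \<int>)"
  unfolding period_lattice_def Ints_def by (auto simp: field_simps image_iff)

quotient_type (overloaded) 'm torus = "real^'m::finite" / "\<lambda>u u'. u - u' \<in> period_lattice"
  morphisms rep_torus torus_of
proof (rule equivpI)
  show "reflp (\<lambda>u u'::real^'m. u - u' \<in> period_lattice)"
    by (simp add: reflp_def period_lattice_iff)
  show "symp (\<lambda>u u'::real^'m. u - u' \<in> period_lattice)"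
    unfolding symp_def period_lattice_iff
    by (metis Ints_minus minus_diff_eq minus_divide_left vector_minus_component)
  show "transp (\<lambda>u u'::real^'m. u - u' \<in> period_lattice)"
    unfolding transp_def period_lattice_iff
  proof safe
    fix x y z :: "real^'m" and a
    assume "\<forall>a. (x - y) $ a / (2 * pi) \<in> \<int>" "\<forall>a. (y - z) $ a / (2 * pi) \<in> \<int>"
    then have "(x - y) $ a / (2 * pi) + (y - z) $ a / (2 * pi) \<in> \<int>" by (intro Ints_add) auto
    then show "(x - z) $ a / (2 * pi) \<in> \<int>" by (simp add: diff_divide_distrib)
  qed
qed

quotient_type (overloaded) 'm dual_torus = "real^'m::finite" / "\<lambda>u u'. u - u' \<in> dual_lattice"
  morphisms rep_dual_torus dual_torus_of
proof (rule equivpI)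
  show "reflp (\<lambda>u u'::real^'m. u - u' \<in> dual_lattice)"
    by (simp add: reflp_def dual_lattice_iff)
  show "symp (\<lambda>u u'::real^'m. u - u' \<in> dual_lattice)"
    unfolding symp_def dual_lattice_iff
    by (metis Ints_minus minus_diff_eq vector_minus_component)
  show "transp (\<lambda>u u'::real^'m. u - u' \<in> dual_lattice)"
    unfolding transp_def dual_lattice_iff
  proof safe
    fix x y z :: "real^'m" and a
    assume "\<forall>a. (x - y) $ a \<in> \<int>" "\<forall>a. (y - z) $ a \<in> \<int>"
    then have "(x - y) $ a + (y - z) $ a \<in> \<int>" by (intro Ints_add) auto
    then show "(x - z) $ a \<in> \<int>" by simp
  qed
qed

text \<open>
  Coordinates: a point \<open>p\<close> of \<open>\<real>\<^sup>2\<^sup>n\<close> is a vector indexed by \<open>'n + 'n\<close> with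
  \<open>x\<^sup>a = p $ Inl a\<close> and \<open>y\<^sup>a = p $ Inr a\<close>, where \<open>n = CARD('n)\<close>; likewise
  \<open>u\<^sup>a\<close>, \<open>v\<^sup>a\<close> are the \<open>Inl a\<close>, \<open>Inr a\<close> components of a representative of a point of
  either torus. The coordinate fields trivialise the tangent bundles of \<open>\<real>\<^sup>2\<^sup>n \<times> T\<^sup>2\<^sup>n\<close> and
  \<open>\<real>\<^sup>2\<^sup>n \<times> (T\<^sup>2\<^sup>n)\<^sup>*\<close>, so every tangent space is \<open>\<real>\<^sup>2\<^sup>n \<times> \<real>\<^sup>2\<^sup>n\<close>.
\<close>

type_synonym 'n base = "real^('n + 'n)"
type_synonym 'n total = "'n base \<times> ('n + 'n) torus"
type_synonym 'n dual_total = "'n base \<times> ('n + 'n) dual_torus"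
type_synonym 'n tangent = "'n base \<times> 'n base"

definition cov :: "'n::finite tangent \<Rightarrow> 'n total"
  where "cov q = (fst q, torus_of (snd q))"

definition dcov :: "'n::finite tangent \<Rightarrow> 'n dual_total"
  where "dcov q = (fst q, dual_torus_of (snd q))"

definition dlift :: "'n::finite dual_total \<Rightarrow> 'n tangent"
  where "dlift p = (fst p, rep_dual_torus (snd p))"

text \<open>A map into the torus is smooth iff it has smooth local lifts, because \<^const>\<open>torus_of\<close>
  is a local diffeomorphism and a covering map.\<close>

definition torus_smooth_on :: "'n::finite base set \<Rightarrow> ('n base \<Rightarrow> ('n + 'n) torus) \<Rightarrow> bool"
  where "torus_smooth_on B h \<longleftrightarrow>
    (\<forall>x\<in>B. \<exists>U f. open U \<and> x \<in> U \<and> U \<subseteq> B \<and> smooth_on U f \<and> (\<forall>z\<in>U. h z = torus_of (f z)))"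


section \<open>The product hyperkaehler structure\<close>

text \<open>The metric is the inner product of \<^typ>\<open>'n::finite tangent\<close>.\<close>

definition mkvec :: "('n \<Rightarrow> real) \<Rightarrow> ('n \<Rightarrow> real) \<Rightarrow> 'n::finite base"
  where "mkvec f g = (\<chi> i. case i of Inl a \<Rightarrow> f a | Inr a \<Rightarrow> g a)"

lemma mkvec_nth [simp]: "mkvec f g $ Inl a = f a" "mkvec f g $ Inr a = g a"
  by (simp_all add: mkvec_def)

definition cxI :: "'n::finite tangent \<Rightarrow> 'n tangent"
  where "cxI = (\<lambda>(p, q). (mkvec (\<lambda>a. - p $ Inr a) (\<lambda>a. p $ Inl a),
                          mkvec (\<lambda>a. - q $ Inr a) (\<lambda>a. q $ Inl a)))"

definition cxJ :: "'n::finite tangent \<Rightarrow> 'n tangent"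
  where "cxJ = (\<lambda>(p, q). (mkvec (\<lambda>a. - q $ Inl a) (\<lambda>a. q $ Inr a),
                          mkvec (\<lambda>a. p $ Inl a) (\<lambda>a. - p $ Inr a)))"

definition cxK :: "'n::finite tangent \<Rightarrow> 'n tangent"
  where "cxK = (\<lambda>(p, q). (mkvec (\<lambda>a. - q $ Inr a) (\<lambda>a. - q $ Inl a),
                          mkvec (\<lambda>a. p $ Inr a) (\<lambda>a. p $ Inl a)))"

definition kform :: "('n::finite tangent \<Rightarrow> 'n tangent) \<Rightarrow> 'n tangent \<Rightarrow> 'n tangent \<Rightarrow> real"
  where "kform L v w = L v \<bullet> w"

abbreviation ddx :: "'n::finite \<Rightarrow> 'n tangent" where "ddx a \<equiv> (axis (Inl a) 1, 0)"
abbreviation ddy :: "'n::finite \<Rightarrow> 'n tangent" where "ddy a \<equiv> (axis (Inr a) 1, 0)"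
abbreviation ddu :: "'n::finite \<Rightarrow> 'n tangent" where "ddu a \<equiv> (0, axis (Inl a) 1)"
abbreviation ddv :: "'n::finite \<Rightarrow> 'n tangent" where "ddv a \<equiv> (0, axis (Inr a) 1)"

lemma base_eqI:
  fixes p q :: "'n::finite base"
  assumes "\<And>a. p $ Inl a = q $ Inl a" "\<And>a. p $ Inr a = q $ Inr a"
  shows "p = q"
  using assms by (metis old.sum.exhaust vec_eq_iff)

lemma hyperkaehler_coordinates:
  "cxI (ddx a) = ddy a" "cxI (ddu a) = ddv a"
  "cxJ (ddx a) = ddu a" "cxJ (ddv a) = ddy a"
  "cxK (ddx a) = ddv a" "cxK (ddy a) = ddu a"
  by (auto simp: cxI_def cxJ_def cxK_def axis_def intro!: base_eqI)

lemma hyperkaehler_quaternions: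
  "cxI (cxI w) = - w" "cxJ (cxJ w) = - w" "cxK (cxK w) = - w" "cxI (cxJ w) = cxK w"
  by (cases w; auto simp: cxI_def cxJ_def cxK_def intro!: base_eqI)+

lemma inner_base:
  fixes p q :: "'n::finite base"
  shows "p \<bullet> q = (\<Sum>a\<in>UNIV. p $ Inl a * q $ Inl a + p $ Inr a * q $ Inr a)"
proof -
  have "p \<bullet> q = (\<Sum>i\<in>UNIV <+> UNIV. p $ i * q $ i)"
    by (simp add: inner_vec_def)
  also have "\<dots> = (\<Sum>a\<in>UNIV. p $ Inl a * q $ Inl a) + (\<Sum>a\<in>UNIV. p $ Inr a * q $ Inr a)"
    by (subst sum.Plus) auto
  finally show ?thesis by (simp add: sum.distrib)
qed

lemma kform_coordinates:
  "kform cxI (p, q) (p', q') = (\<Sum>a\<in>UNIV.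
     (p $ Inl a * p' $ Inr a - p' $ Inl a * p $ Inr a) +
     (q $ Inl a * q' $ Inr a - q' $ Inl a * q $ Inr a))"
  "kform cxJ (p, q) (p', q') = (\<Sum>a\<in>UNIV.
     (p $ Inl a * q' $ Inl a - p' $ Inl a * q $ Inl a) +
     (q $ Inr a * p' $ Inr a - q' $ Inr a * p $ Inr a))"
  "kform cxK (p, q) (p', q') = (\<Sum>a\<in>UNIV.
     (p $ Inl a * q' $ Inr a - p' $ Inl a * q $ Inr a) +
     (p $ Inr a * q' $ Inl a - p' $ Inr a * q $ Inl a))"
  by (simp_all add: kform_def cxI_def cxJ_def cxK_def inner_base flip: sum.distrib)
     (rule sum.cong; simp add: algebra_simps)+


section \<open>Complex Lagrangian submanifolds\<close>

text \<open>Embedded submanifolds of \<open>\<real>\<^sup>2\<^sup>n \<times> T\<^sup>2\<^sup>n\<close>, by slice charts. The charts of the ambient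
  manifold are the local inverses of \<^const>\<open>cov\<close>.\<close>

definition submanifold :: "nat \<Rightarrow> 'n::finite total set \<Rightarrow> bool"
  where "submanifold d L \<longleftrightarrow>
    (\<forall>p\<in>L. \<exists>(N :: 'n tangent set) (\<phi> :: 'n tangent \<Rightarrow> 'n tangent) \<psi> E.
       open N \<and> p \<in> cov ` N \<and> inj_on cov N \<and>
       smooth_on N \<phi> \<and> open (\<phi> ` N) \<and> smooth_on (\<phi> ` N) \<psi> \<and> (\<forall>q\<in>N. \<psi> (\<phi> q) = q) \<and>
       subspace E \<and> dim E = d \<and> \<phi> ` (N \<inter> cov -` L) = \<phi> ` N \<inter> E)"

text \<open>Velocities of smooth curves in \<open>L\<close>, written through their lifts.\<close>

definition tangent_space :: "'n::finite total set \<Rightarrow> 'n total \<Rightarrow> 'n tangent set"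
  where "tangent_space L p =
    {w. \<exists>c \<epsilon>. \<epsilon> > 0 \<and> smooth_on {-\<epsilon><..<\<epsilon>} c \<and> cov (c 0) = p \<and>
          (\<forall>t\<in>{-\<epsilon><..<\<epsilon>}. cov (c t) \<in> L) \<and> (c has_vector_derivative w) (at (0::real))}"

definition complex_submanifold ::
    "('n::finite tangent \<Rightarrow> 'n tangent) \<Rightarrow> 'n total set \<Rightarrow> bool"
  where "complex_submanifold C L \<longleftrightarrow>
    (\<forall>p\<in>L. \<forall>w\<in>tangent_space L p. C w \<in> tangent_space L p)"

definition lagrangian ::
    "('n::finite tangent \<Rightarrow> 'n tangent \<Rightarrow> real) \<Rightarrow> 'n total set \<Rightarrow> bool"
  where "lagrangian \<omega> L \<longleftrightarrow> submanifold (2 * CARD('n)) L \<and>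
    (\<forall>p\<in>L. \<forall>w\<in>tangent_space L p. \<forall>w'\<in>tangent_space L p. \<omega> w w' = 0)"

definition complex_lagrangian :: "'n::finite total set \<Rightarrow> 'n total set \<Rightarrow> bool"
  where "complex_lagrangian X L \<longleftrightarrow> L \<subseteq> X \<and> submanifold (2 * CARD('n)) L \<and>
    complex_submanifold cxI L \<and> lagrangian (kform cxJ) L \<and> lagrangian (kform cxK) L"

lemma torus_of_eq_iff: "torus_of u = torus_of u' \<longleftrightarrow> u - u' \<in> period_lattice"
  by (rule torus.abs_eq_iff)

lemma period_lattice_small:
  assumes "k \<in> period_lattice" "norm k < 2"
  shows "k = 0"
proof -
  have "k $ a = 0" for a
  proof -
    obtain j :: int where j: "k $ a = 2 * pi * of_int j"
      using assms(1) unfolding period_lattice_def by blast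
    have "\<bar>k $ a\<bar> < 2"
      using component_le_norm_cart[of k a] assms(2) by linarith
    have "j = 0"
    proof (rule ccontr)
      assume "j \<noteq> 0"
      then have "1 \<le> \<bar>real_of_int j\<bar>" by linarith
      then have "2 * pi * 1 \<le> 2 * pi * \<bar>real_of_int j\<bar>"
        by (intro mult_left_mono) auto
      then have "2 * pi \<le> \<bar>k $ a\<bar>" by (simp add: j abs_mult)
      with \<open>\<bar>k $ a\<bar> < 2\<close> pi_ge_two show False by linarith
    qed
    with j show ?thesis by simp
  qed
  then show ?thesis by (simp add: vec_eq_iff)
qed

text \<open>The coordinates are normalised so that the base directions are complex Lagrangian for \<open>I\<close>.\<close>

lemma base_complex_lagrangian:
  fixes B :: "'n::finite base set"
  assumes B: "open B"
  shows "complex_lagrangian (B \<times> UNIV) (B \<times> {t})"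
proof -
  obtain u0 where u0: "torus_of u0 = t"
    using Quotient3_abs_rep[OF Quotient3_torus, of t] by blast
  have sub: "submanifold (2 * CARD('n)) (B \<times> {t})"
    unfolding submanifold_def
  proof
    fix p assume p: "p \<in> B \<times> {t}"
    define N :: "'n tangent set" where "N = B \<times> ball u0 1"
    define E :: "'n tangent set" where "E = UNIV \<times> {0}"
    have small: "u = u'"
      if "u \<in> ball u0 1" "u' \<in> ball u0 1" "u - u' \<in> period_lattice" for u u'
    proof -
      have "dist u u' < 2"
        using that(1,2) dist_triangle2[of u u' u0] by (auto simp: dist_commute)
      then show ?thesis
        using period_lattice_small[OF that(3)] by (simp add: dist_norm)
    qed
    have "open N" unfolding N_def using B by (simp add: open_Times)
    moreover have "p \<in> cov ` N"
      using p u0 by (intro image_eqI[of _ _ "(fst p, u0)"]) (auto simp: N_def cov_def)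
    moreover have "inj_on cov N"
      by (rule inj_onI) (auto simp: N_def cov_def torus_of_eq_iff intro: small)
    moreover have "smooth_on N (\<lambda>q. (0, - u0) + q)" "smooth_on ((\<lambda>q. (0, - u0) + q) ` N) (\<lambda>q. (0, u0) + q)"
      by (rule smooth_on_affine, rule bounded_linear_ident)+
    moreover have "open ((\<lambda>q. (0, - u0) + q) ` N)"
      by (rule open_translation) fact
    moreover have "\<forall>q\<in>N. (0, u0) + ((0, - u0) + q) = q" by (auto simp: prod_eq_iff)
    moreover have "subspace E"
      unfolding E_def by (intro subspace_Times) auto
    moreover have "dim E = 2 * CARD('n)"
      unfolding E_def by (subst dim_Times) (auto simp: dim_UNIV)
    moreover have "(\<lambda>q. (0, - u0) + q) ` (N \<inter> cov -` (B \<times> {t})) = (\<lambda>q. (0, - u0) + q) ` N \<inter> E"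
    proof -
      have "q \<in> cov -` (B \<times> {t}) \<longleftrightarrow> (0, - u0) + q \<in> E" if "q \<in> N" for q
        using that u0 small[of "snd q" u0]
        by (cases q) (auto simp: N_def E_def cov_def torus_of_eq_iff period_lattice_iff simp flip: u0)
      then show ?thesis by blast
    qed
    ultimately show "\<exists>(N :: 'n tangent set) (\<phi> :: 'n tangent \<Rightarrow> 'n tangent) \<psi> E.
       open N \<and> p \<in> cov ` N \<and> inj_on cov N \<and>
       smooth_on N \<phi> \<and> open (\<phi> ` N) \<and> smooth_on (\<phi> ` N) \<psi> \<and> (\<forall>q\<in>N. \<psi> (\<phi> q) = q) \<and>
       subspace E \<and> dim E = 2 * CARD('n) \<and> \<phi> ` (N \<inter> cov -` (B \<times> {t})) = \<phi> ` N \<inter> E"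
      by (intro exI conjI) assumption+
  qed
  have T1: "snd w = 0" if w: "w \<in> tangent_space (B \<times> {t}) p" for p w
  proof -
    obtain c \<epsilon> where c: "\<epsilon> > 0" "\<And>s. s \<in> {-\<epsilon><..<\<epsilon>} \<Longrightarrow> cov (c s) \<in> B \<times> {t}"
      "(c has_vector_derivative w) (at (0::real))"
      using w unfolding tangent_space_def by blast
    have D: "((\<lambda>s. snd (c s)) has_vector_derivative snd w) (at 0)"
      using bounded_linear.has_vector_derivative[OF bounded_linear_snd c(3)] .
    have cont: "isCont (\<lambda>s. snd (c s)) 0"
      using D by (rule has_vector_derivative_continuous)
    have ev1: "\<forall>\<^sub>F s in at 0. dist (snd (c s)) (snd (c 0)) < 2"
      using cont unfolding isCont_def tendsto_iff by auto
    have ev2: "\<forall>\<^sub>F s in at 0. s \<in> {-\<epsilon><..<\<epsilon>}"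
      using c(1) by (intro eventually_at_in_open') auto
    have "\<forall>\<^sub>F s in at 0. snd (c s) = snd (c 0)"
      using ev1 ev2
    proof eventually_elim
      case (elim s)
      have "cov (c s) \<in> B \<times> {t}" "cov (c 0) \<in> B \<times> {t}" using elim c(1,2) by auto
      then have "torus_of (snd (c s)) = torus_of (snd (c 0))" by (simp add: cov_def)
      then have "snd (c s) - snd (c 0) \<in> period_lattice" by (simp add: torus_of_eq_iff)
      then have "snd (c s) - snd (c 0) = 0"
        using elim by (intro period_lattice_small) (auto simp: dist_norm)
      then show ?case by simp
    qed
    then have "((\<lambda>s. snd (c 0)) has_vector_derivative snd w) (at 0)"
      using D has_derivative_transform_eventually[of "\<lambda>s. snd (c s)" _ 0 UNIV "\<lambda>s. snd (c 0)"]
      unfolding has_vector_derivative_def by auto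
    then show ?thesis
      using has_vector_derivative_const vector_derivative_unique_at by blast
  qed
  have T2: "w \<in> tangent_space (B \<times> {t}) p" if p: "p \<in> B \<times> {t}" and w: "snd w = 0" for p w
  proof -
    define c where "c s = (fst p, u0) + s *\<^sub>R w" for s :: real
    have "continuous_on UNIV (\<lambda>s. fst (c s))" unfolding c_def by (intro continuous_intros)
    then have "open ((\<lambda>s. fst (c s)) -` B)" using B by (rule open_vimage[rotated])
    moreover have "0 \<in> (\<lambda>s. fst (c s)) -` B" using p by (auto simp: c_def)
    ultimately obtain \<epsilon> where \<epsilon>: "\<epsilon> > 0" "ball 0 \<epsilon> \<subseteq> (\<lambda>s. fst (c s)) -` B"
      by (meson openE)
    have "smooth_on {-\<epsilon><..<\<epsilon>} c"
      unfolding c_def by (intro smooth_on_affine bounded_linear_scaleR_left)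
    moreover have "cov (c 0) = p" using p u0 by (auto simp: c_def cov_def)
    moreover have "\<forall>s\<in>{-\<epsilon><..<\<epsilon>}. cov (c s) \<in> B \<times> {t}"
    proof
      fix s assume "s \<in> {-\<epsilon><..<\<epsilon>}"
      then have "s \<in> ball 0 \<epsilon>" by auto
      then have "fst (c s) \<in> B" using \<epsilon>(2) by blast
      then show "cov (c s) \<in> B \<times> {t}" using u0 w by (simp add: cov_def c_def)
    qed
    moreover have "(c has_vector_derivative w) (at 0)"
      unfolding c_def by (auto intro!: derivative_eq_intros)
    ultimately show ?thesis using \<epsilon>(1) unfolding tangent_space_def by blast
  qed
  have "snd (cxI w) = 0" if "snd w = 0" for w :: "'n tangent"
    using that by (cases w) (auto simp: cxI_def intro!: base_eqI)
  then have "complex_submanifold cxI (B \<times> {t})"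
    unfolding complex_submanifold_def using T1 T2 by blast
  moreover have "kform cxJ w w' = 0" "kform cxK w w' = 0"
    if "snd w = 0" "snd w' = 0" for w w' :: "'n tangent"
    using that by (cases w; cases w'; simp add: kform_coordinates)+
  then have "lagrangian (kform cxJ) (B \<times> {t})" "lagrangian (kform cxK) (B \<times> {t})"
    unfolding lagrangian_def using sub T1 by blast+
  ultimately show ?thesis
    unfolding complex_lagrangian_def using sub by auto
qed

definition graph_on :: "'n::finite base set \<Rightarrow> ('n base \<Rightarrow> ('n + 'n) torus) \<Rightarrow> 'n total set"
  where "graph_on B h = {(x, h x) | x. x \<in> B}"


section \<open>Connections on Hermitian line bundles over \<open>B \<times> (T\<^sup>2\<^sup>n)\<^sup>*\<close>\<close>

text \<open>
  A line bundle with connection is presented by local unitary trivialisations: on the patch \<open>i\<close>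
  the connection is \<open>d + A\<^sub>i\<close> on the trivial line bundle, and a section \<open>s\<close> with local
  expressions \<open>s\<^sub>i\<close> satisfies \<open>s\<^sub>i = g\<^sub>i\<^sub>j s\<^sub>j\<close> on overlaps, whence
  \<open>A\<^sub>j - A\<^sub>i = g\<^sub>i\<^sub>j\<^sup>-\<^sup>1 dg\<^sub>i\<^sub>j\<close>.
\<close>

record ('i, 'n) line_conn =
  patches :: "'i set"
  patch_dom :: "'i \<Rightarrow> 'n dual_total set"
  conn_form :: "'i \<Rightarrow> 'n dual_total \<Rightarrow> 'n tangent \<Rightarrow> complex"
  transition :: "'i \<Rightarrow> 'i \<Rightarrow> 'n dual_total \<Rightarrow> complex"

definition hermitian_connection :: "'n::finite dual_total set \<Rightarrow> ('i, 'n) line_conn \<Rightarrow> bool"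
  where "hermitian_connection M D \<longleftrightarrow>
    (\<Union>i\<in>patches D. patch_dom D i) = M \<and>
    (\<forall>i\<in>patches D.
       open (dcov -` patch_dom D i) \<and>
       (\<forall>p\<in>patch_dom D i. linear (conn_form D i p) \<and> (\<forall>w. Re (conn_form D i p w) = 0)) \<and>
       (\<forall>w. smooth_on (dcov -` patch_dom D i) (\<lambda>q. conn_form D i (dcov q) w))) \<and>
    (\<forall>i\<in>patches D. \<forall>j\<in>patches D.
       (\<forall>p\<in>patch_dom D i \<inter> patch_dom D j. norm (transition D i j p) = 1) \<and>
       (\<forall>q\<in>dcov -` (patch_dom D i \<inter> patch_dom D j).
          ((\<lambda>q. transition D i j (dcov q)) has_derivative
           (\<lambda>w. (conn_form D j (dcov q) w - conn_form D i (dcov q) w) * transition D i j (dcov q)))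
          (at q))) \<and>
    (\<forall>i\<in>patches D. \<forall>j\<in>patches D. \<forall>k\<in>patches D.
       \<forall>p\<in>patch_dom D i \<inter> patch_dom D j \<inter> patch_dom D k.
         transition D i j p * transition D j k p = transition D i k p)"

text \<open>\<open>d\<alpha>(v, w) = v(\<alpha>(w)) - w(\<alpha>(v))\<close> for constant fields \<open>v\<close>, \<open>w\<close>.\<close>

definition ext_deriv ::
    "('n::finite dual_total \<Rightarrow> 'n tangent \<Rightarrow> complex)
     \<Rightarrow> 'n dual_total \<Rightarrow> 'n tangent \<Rightarrow> 'n tangent \<Rightarrow> complex"
  where "ext_deriv \<alpha> p v w =
    frechet_derivative (\<lambda>q. \<alpha> (dcov q) w) (at (dlift p)) v -
    frechet_derivative (\<lambda>q. \<alpha> (dcov q) v) (at (dlift p)) w"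

text \<open>In rank one \<open>A \<and> A = 0\<close>, so the curvature \<open>dA + A \<and> A\<close> is \<open>dA\<close>.\<close>

definition curvature ::
    "('i, 'n::finite) line_conn \<Rightarrow> 'i \<Rightarrow> 'n dual_total \<Rightarrow> 'n tangent \<Rightarrow> 'n tangent \<Rightarrow> complex"
  where "curvature D i = ext_deriv (conn_form D i)"

text \<open>
  The complex-bilinear extension of \<open>F\<close> evaluated on the projections \<open>(v + i Lv) / 2\<close>,
  \<open>(w + i Lw) / 2\<close> of \<open>v\<close>, \<open>w\<close> to \<open>T\<^sup>0\<^sup>,\<^sup>1\<close>, the \<open>-i\<close>-eigenspace of \<open>L\<close>.
\<close>

definition component02 ::
    "('v \<Rightarrow> 'v) \<Rightarrow> ('v \<Rightarrow> 'v \<Rightarrow> complex) \<Rightarrow> 'v \<Rightarrow> 'v \<Rightarrow> complex"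
  where "component02 L F v w =
    (F v w + \<i> * F (L v) w + \<i> * F v (L w) - F (L v) (L w)) / 4"

text \<open>A \<open>k\<close>-form on a vector space is a function of a sequence of vectors, of which only the
  first \<open>k\<close> entries matter.\<close>

type_synonym 'v form = "(nat \<Rightarrow> 'v) \<Rightarrow> complex"

definition two_form :: "('v \<Rightarrow> 'v \<Rightarrow> complex) \<Rightarrow> 'v form"
  where "two_form F = (\<lambda>V. F (V 0) (V 1))"

definition wedge :: "nat \<Rightarrow> nat \<Rightarrow> 'v form \<Rightarrow> 'v form \<Rightarrow> 'v form"
  where "wedge k l \<alpha> \<beta> = (\<lambda>V.
    (\<Sum>\<sigma> | \<sigma> permutes {..<k + l}.
       of_int (sign \<sigma>) * \<alpha> (\<lambda>i. V (\<sigma> i)) * \<beta> (\<lambda>i. V (\<sigma> (k + i)))) / (fact k * fact l))"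

primrec wedge_power :: "'v form \<Rightarrow> nat \<Rightarrow> 'v form"
  where
    "wedge_power \<omega> 0 = (\<lambda>_. 1)"
  | "wedge_power \<omega> (Suc m) = wedge 2 (2 * m) \<omega> (wedge_power \<omega> m)"

definition primitive_HYM ::
    "('n::finite tangent \<Rightarrow> 'n tangent) \<Rightarrow> ('i, 'n) line_conn \<Rightarrow> bool"
  where "primitive_HYM L D \<longleftrightarrow>
    (\<forall>i\<in>patches D. \<forall>p\<in>patch_dom D i.
       component02 L (curvature D i p) = (\<lambda>v w. 0) \<and>
       wedge 2 (2 * (2 * CARD('n) - 1)) (two_form (curvature D i p))
         (wedge_power (two_form (\<lambda>v w. of_real (kform L v w))) (2 * CARD('n) - 1)) = (\<lambda>V. 0))"

definition Sp_instanton :: "'n::finite dual_total set \<Rightarrow> ('i, 'n) line_conn \<Rightarrow> bool"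
  where "Sp_instanton M D \<longleftrightarrow> hermitian_connection M D \<and>
    primitive_HYM cxI D \<and> primitive_HYM cxJ D \<and> primitive_HYM cxK D"


section \<open>The real Fourier-Mukai transform\<close>

text \<open>
  The patches are \<open>U \<times> (T\<^sup>2\<^sup>n)\<^sup>*\<close> for the smooth local lifts \<open>f : U \<rightarrow> \<real>\<^sup>2\<^sup>n\<close> of \<open>h\<close>. Two lifts
  \<open>f\<close>, \<open>f'\<close> differ by a locally constant function with values in \<open>(2\<pi>\<int>)\<^sup>2\<^sup>n\<close>, and the
  connection forms by the gauge transformation \<open>exp (i (f' - f) \<sqdot> u)\<close>. If \<open>h\<close> has a global
  lift this is a connection on the trivial line bundle; otherwise the curvature need not be
  exact, and only the local expressions live on trivial bundles.
\<close>

definition fourier_mukai ::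
    "'n::finite base set \<Rightarrow> ('n base \<Rightarrow> ('n + 'n) torus)
     \<Rightarrow> ('n base set \<times> ('n base \<Rightarrow> 'n base), 'n) line_conn"
  where "fourier_mukai B h =
    \<lparr> patches = {(U, f). open U \<and> U \<subseteq> B \<and> smooth_on U f \<and> (\<forall>x\<in>U. h x = torus_of (f x))},
      patch_dom = (\<lambda>(U, f). U \<times> UNIV),
      conn_form = (\<lambda>(U, f) p w. \<i> * of_real
        (\<Sum>a\<in>UNIV. f (fst p) $ Inl a * snd w $ Inl a + f (fst p) $ Inr a * snd w $ Inr a)),
      transition = (\<lambda>(U, f) (U', f') p. cis ((f' (fst p) - f (fst p)) \<bullet> snd (dlift p))) \<rparr>"

end

theory Submission
  imports Defs
begin

text \<open>
  Locally \<open>h\<close> lifts to a smooth map \<open>f\<close>. Let \<open>A\<close> be the derivative of \<open>f\<close> at a point. Both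
  sides of the equivalence are conditions on the linear maps \<open>A\<close> alone. The tangent space of
  the graph of \<open>h\<close> is the graph \<open>\<Gamma>\<close> of \<open>A\<close>, and the curvature of the transform is \<open>i G\<close>
  with \<open>G v w = A p \<bullet> q' - A p' \<bullet> q\<close> for \<open>v = (p, q)\<close>, \<open>w = (p', q')\<close>
  (\<open>tangent_space_graph\<close>, \<open>fourier_mukai_curvature\<close>).

  An imaginary 2-form has no (0,2) part with respect to \<open>C\<close> iff it is invariant under \<open>C\<close>.
  The structure \<open>I\<close> acts on both factors of \<open>\<real>\<^sup>2\<^sup>n \<times> \<real>\<^sup>2\<^sup>n\<close> by the same rotation \<open>R\<close>, and
  invariance of \<open>G\<close> under \<open>I\<close> says that \<open>A\<close> commutes with \<open>R\<close>, that is, \<open>I \<Gamma> \<subseteq> \<Gamma>\<close>. The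
  structures \<open>J\<close> and \<open>K\<close> have the form \<open>(p, q) \<mapsto> (- S q, S p)\<close> for a symmetric involution
  \<open>S\<close>; invariance of \<open>G\<close> under such a structure says that \<open>S A\<close> is symmetric, that is, the
  corresponding Kaehler form vanishes on \<open>\<Gamma>\<close>. So the three type conditions on the curvature
  match the three conditions on the graph one by one.

  There remain the equations \<open>F \<and> \<omega>\<^sub>L\<^sup>2\<^sup>n\<^sup>-\<^sup>1 = 0\<close>. They follow from the type conditions. Let
  \<open>M\<close> be one of the structures that anticommute with \<open>L\<close>. Then \<open>L\<close> preserves \<open>\<omega>\<^sub>L\<close> and \<open>M\<close>
  reverses its sign, while both preserve \<open>F\<close>. The exponent is odd, so the top-degree form
  \<open>\<eta> = F \<and> \<omega>\<^sub>L\<^sup>2\<^sup>n\<^sup>-\<^sup>1\<close> is preserved by \<open>L\<close> and reversed by \<open>M\<close>. But \<open>L\<close> and \<open>M\<close> are conjugate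
  through the invertible map \<open>L + M\<close>, hence have equal determinants and act by the same scalar
  on forms of top degree. Therefore \<open>\<eta> = 0\<close> (\<open>wedge_kform_power_eq_0\<close>). The determinant itself
  is replaced by the fact that forms of top degree are proportional.
\<close>

section \<open>Calculus of smooth maps\<close>

lemma Ck_on_cong:
  assumes "open S" "\<And>x. x \<in> S \<Longrightarrow> f x = g x"
  shows "Ck_on k S f \<longleftrightarrow> Ck_on k S g"
  using assms(2)
proof (induction k arbitrary: f g)
  case 0
  then show ?case by (simp cong: continuous_on_cong)
next
  case (Suc k)
  have D: "(f has_derivative f') (at x) \<longleftrightarrow> (g has_derivative f') (at x)" if "x \<in> S" for x f'
  proof
    show "(g has_derivative f') (at x)" if "(f has_derivative f') (at x)"
      using that assms(1) \<open>x \<in> S\<close> by (rule has_derivative_transform_within_open) (rule Suc.prems)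
    show "(f has_derivative f') (at x)" if "(g has_derivative f') (at x)"
      using that assms(1) \<open>x \<in> S\<close>
      by (rule has_derivative_transform_within_open) (rule Suc.prems[symmetric])
  qed
  then have "frechet_derivative f (at x) = frechet_derivative g (at x)" if "x \<in> S" for x
    using that unfolding frechet_derivative_def by simp
  then have "Ck_on k S (\<lambda>x. frechet_derivative f (at x) v) \<longleftrightarrow>
      Ck_on k S (\<lambda>x. frechet_derivative g (at x) v)" for v
    by (intro Suc.IH) simp
  then show ?case using D by (simp add: differentiable_def)
qed

lemma Ck_on_add:
  assumes "open S" "Ck_on k S f" "Ck_on k S g"
  shows "Ck_on k S (\<lambda>x. f x + g x)"
  using assms(2,3)
proof (induction k arbitrary: f g)
  case 0
  then show ?case by (simp add: continuous_on_add)
next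
  case (Suc k)
  have D: "((\<lambda>x. f x + g x) has_derivative
      (\<lambda>v. frechet_derivative f (at x) v + frechet_derivative g (at x) v)) (at x)" if "x \<in> S" for x
    using that Suc.prems by (intro has_derivative_add) (simp_all flip: frechet_derivative_works)
  have "Ck_on k S (\<lambda>x. frechet_derivative (\<lambda>x. f x + g x) (at x) v)" for v
  proof -
    have "Ck_on k S (\<lambda>x. frechet_derivative f (at x) v + frechet_derivative g (at x) v)"
      using Suc by simp
    then show ?thesis
      by (rule Ck_on_cong[OF assms(1), THEN iffD2, rotated])
        (simp flip: frechet_derivative_at[OF D])
  qed
  then show ?case using D by (auto simp: differentiable_def)
qed

text \<open>
  Pre-composition with affine maps and post-composition with linear maps commute with taking
  directional derivatives, so an induction on the order suffices here, without the Faa di Bruno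
  bookkeeping of a general chain rule. All maps built from local lifts below are sums of such
  composites.
\<close>

lemma Ck_on_affine_compose:
  assumes "bounded_linear L" "bounded_linear l"
    and "open S" "open T" "\<And>x. x \<in> T \<Longrightarrow> c + l x \<in> S" "Ck_on k S f"
  shows "Ck_on k T (\<lambda>x. L (f (c + l x)))"
  using assms(6)
proof (induction k arbitrary: f)
  case 0
  have "continuous_on T (\<lambda>x. f (c + l x))"
    using 0 assms(5)
    by (intro continuous_on_compose2[of S f T] continuous_on_add continuous_on_const
        linear_continuous_on[OF assms(2)]) auto
  then show ?case using bounded_linear.continuous_on[OF assms(1)] by simp
next
  case (Suc k)
  have D: "((\<lambda>x. L (f (c + l x))) has_derivative
      (\<lambda>v. L (frechet_derivative f (at (c + l x)) (l v)))) (at x)" if "x \<in> T" for x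
  proof -
    have "((\<lambda>x. c + l x) has_derivative l) (at x)"
      using bounded_linear_imp_has_derivative[OF assms(2)] by (auto intro!: derivative_eq_intros)
    moreover have "(f has_derivative frechet_derivative f (at (c + l x))) (at (c + l x))"
      using Suc.prems assms(5) that by (simp add: frechet_derivative_works)
    ultimately have "((\<lambda>x. f (c + l x)) has_derivative
        (\<lambda>v. frechet_derivative f (at (c + l x)) (l v))) (at x)"
      by (rule has_derivative_compose)
    then show ?thesis by (rule bounded_linear.has_derivative[OF assms(1)])
  qed
  have "Ck_on k T (\<lambda>x. frechet_derivative (\<lambda>x. L (f (c + l x))) (at x) v)" for v
  proof -
    have "Ck_on k T (\<lambda>x. L (frechet_derivative f (at (c + l x)) (l v)))"
      using Suc.IH[of "\<lambda>y. frechet_derivative f (at y) (l v)"] Suc.prems by simp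
    then show ?thesis
      by (rule Ck_on_cong[OF assms(4), THEN iffD2, rotated])
        (simp flip: frechet_derivative_at[OF D])
  qed
  then show ?case using D by (auto simp: differentiable_def)
qed

lemma smooth_on_add:
  "open S \<Longrightarrow> smooth_on S f \<Longrightarrow> smooth_on S g \<Longrightarrow> smooth_on S (\<lambda>x. f x + g x)"
  by (simp add: smooth_on_def Ck_on_add)

lemma smooth_on_affine_compose:
  assumes "smooth_on S f" "open S" "open T" "bounded_linear L" "bounded_linear l"
    and "\<And>x. x \<in> T \<Longrightarrow> c + l x \<in> S"
  shows "smooth_on T (\<lambda>x. L (f (c + l x)))"
  using assms by (simp add: smooth_on_def Ck_on_affine_compose)

lemma smooth_on_has_derivative:
  assumes "smooth_on S f" "x \<in> S"
  shows "(f has_derivative frechet_derivative f (at x)) (at x)"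
proof -
  have "Ck_on (Suc 0) S f" using assms(1) unfolding smooth_on_def by blast
  then show ?thesis using assms(2) by (simp add: frechet_derivative_works)
qed

lemma smooth_on_continuous_on: "smooth_on S f \<Longrightarrow> continuous_on S f"
  unfolding smooth_on_def by (metis Ck_on.simps(1))

section \<open>Alternating forms of top degree\<close>

definition multilinear_form :: "nat \<Rightarrow> 'v::real_vector form \<Rightarrow> bool"
  where "multilinear_form N f \<longleftrightarrow>
    (\<forall>V W. (\<forall>i<N. V i = W i) \<longrightarrow> f V = f W) \<and>
    (\<forall>V. \<forall>j<N. linear (\<lambda>x. f (V(j := x))))"

lemma multilinear_form_cong:
  "multilinear_form N f \<Longrightarrow> (\<And>i. i < N \<Longrightarrow> V i = W i) \<Longrightarrow> f V = f W"
  unfolding multilinear_form_def by (elim conjE) metis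

lemma multilinear_form_linear:
  "multilinear_form N f \<Longrightarrow> j < N \<Longrightarrow> linear (\<lambda>x. f (V(j := x)))"
  unfolding multilinear_form_def by simp

text \<open>
  Antisymmetry is expressed through all permutations of the arguments rather than through
  transpositions, because that is the form in which a wedge product delivers it.
\<close>

definition alternating_form :: "nat \<Rightarrow> 'v::real_vector form \<Rightarrow> bool"
  where "alternating_form N f \<longleftrightarrow> multilinear_form N f \<and>
    (\<forall>V \<sigma>. \<sigma> permutes {..<N} \<longrightarrow> f (\<lambda>i. V (\<sigma> i)) = of_int (sign \<sigma>) * f V)"

lemma alternating_form_cong:
  "alternating_form N f \<Longrightarrow> (\<And>i. i < N \<Longrightarrow> V i = W i) \<Longrightarrow> f V = f W"
  unfolding alternating_form_def by (metis multilinear_form_cong)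

lemma alternating_form_linear:
  "alternating_form N f \<Longrightarrow> j < N \<Longrightarrow> linear (\<lambda>x. f (V(j := x)))"
  unfolding alternating_form_def by (elim conjE) (rule multilinear_form_linear)

lemma alternating_form_permute:
  "alternating_form N f \<Longrightarrow> \<sigma> permutes {..<N} \<Longrightarrow> f (\<lambda>i. V (\<sigma> i)) = of_int (sign \<sigma>) * f V"
  unfolding alternating_form_def by (elim conjE) simp

lemma alternating_form_repeated:
  assumes f: "alternating_form N f" and ij: "i < N" "j < N" "i \<noteq> j" "V i = V j"
  shows "f V = 0"
proof -
  have "(\<lambda>k. V (Transposition.transpose i j k)) = V"
    using ij by (auto simp: Transposition.transpose_def)
  moreover have "f (\<lambda>k. V (Transposition.transpose i j k)) = of_int (sign (Transposition.transpose i j)) * f V"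
    using ij by (intro alternating_form_permute[OF f] permutes_swap_id) auto
  ultimately show ?thesis using ij by (simp add: sign_swap_id)
qed

text \<open>
  The values on an arbitrary sequence are reduced to the values on sequences of basis vectors by
  replacing one argument after the other by linearity. A sequence of \<open>N\<close> vectors from a spanning
  set of size \<open>N\<close> either repeats a vector or is a rearrangement of \<open>V\<close>.
\<close>

lemma alternating_form_eq_0:
  assumes f: "alternating_form N f" and V: "bij_betw V {..<N} Bs" "span Bs = UNIV" "f V = 0"
  shows "f W = 0"
proof -
  have basis: "f W = 0" if W: "\<And>i. i < N \<Longrightarrow> W i \<in> Bs" for W
  proof (cases "inj_on W {..<N}")
    case False
    then show ?thesis using alternating_form_repeated[OF f] by (auto simp: inj_on_def)
  next
    case True
    \<comment> \<open>The rearrangement is extended by the identity, as permutations act on all of \<open>\<nat>\<close>.\<close>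
    define \<sigma> where "\<sigma> i = (if i < N then inv_into {..<N} V (W i) else i)" for i
    have "finite Bs" "card Bs = N"
      using V(1) bij_betw_finite[OF V(1)] bij_betw_same_card[OF V(1)] by auto
    then have "W ` {..<N} = Bs"
      using W True by (intro card_subset_eq) (auto simp: card_image)
    then have "bij_betw W {..<N} Bs" using True by (simp add: bij_betw_def)
    then have "bij_betw (inv_into {..<N} V \<circ> W) {..<N} {..<N}"
      using bij_betw_inv_into[OF V(1)] by (rule bij_betw_trans)
    then have "bij_betw \<sigma> {..<N} {..<N}"
      by (rule bij_betw_cong[THEN iffD1, rotated]) (simp add: \<sigma>_def)
    then have \<sigma>: "\<sigma> permutes {..<N}"
      by (rule bij_imp_permutes) (simp add: \<sigma>_def)
    have "W i = V (\<sigma> i)" if "i < N" for i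
      using that W V(1) by (simp add: \<sigma>_def bij_betw_def f_inv_into_f)
    then have "f W = f (\<lambda>i. V (\<sigma> i))" by (rule alternating_form_cong[OF f])
    also have "\<dots> = of_int (sign \<sigma>) * f V" by (rule alternating_form_permute[OF f \<sigma>])
    finally show ?thesis using V(3) by simp
  qed
  \<comment> \<open>The first \<open>k\<close> arguments have been freed from the basis.\<close>
  have "\<forall>W. (\<forall>i\<in>{k..<N}. W i \<in> Bs) \<longrightarrow> f W = 0" if "k \<le> N" for k
    using that
  proof (induction k)
    case 0
    then show ?case using basis by simp
  next
    case (Suc k)
    show ?case
    proof (intro allI impI)
      fix W assume W: "\<forall>i\<in>{Suc k..<N}. W i \<in> Bs"
      have lin: "linear (\<lambda>x. f (W(k := x)))"
        using Suc.prems by (intro alternating_form_linear[OF f]) simp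
      have "f (W(k := b)) = 0" if "b \<in> Bs" for b
        using Suc W that by (auto simp: Ball_def)
      then have "f (W(k := x)) = 0" for x
        using linear_eq_0_on_span[OF lin, of Bs x] V(2) by auto
      from this[of "W k"] show "f W = 0" by simp
    qed
  qed
  then show ?thesis by (metis order.refl atLeastLessThan_empty empty_iff)
qed

lemma alternating_form_lincomb:
  assumes "alternating_form N f" "alternating_form N g"
  shows "alternating_form N (\<lambda>V. a * f V + b * g V)"
  unfolding alternating_form_def multilinear_form_def
proof (intro conjI allI impI)
  fix V W :: "nat \<Rightarrow> 'a" assume "\<forall>i<N. V i = W i"
  then show "a * f V + b * g V = a * f W + b * g W"
    using assms[THEN alternating_form_cong, of V W] by simp
next
  fix V j assume "j < N"
  then show "linear (\<lambda>x. a * f (V(j := x)) + b * g (V(j := x)))"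
    using assms[THEN alternating_form_linear, of j V] by (simp add: linear_iff algebra_simps)
next
  fix V \<sigma> assume "\<sigma> permutes {..<N}"
  then show "a * f (\<lambda>i. V (\<sigma> i)) + b * g (\<lambda>i. V (\<sigma> i)) =
      of_int (sign \<sigma>) * (a * f V + b * g V)"
    using assms[THEN alternating_form_permute, of \<sigma> V] by (simp add: algebra_simps)
qed

lemma alternating_form_pullback:
  assumes f: "alternating_form N f" and M: "linear M"
  shows "alternating_form N (\<lambda>V. f (\<lambda>i. M (V i)))"
  unfolding alternating_form_def multilinear_form_def
proof (intro conjI allI impI)
  fix V j assume j: "j < N"
  have "(\<lambda>i. M ((V(j := x)) i)) = (\<lambda>i. M (V i))(j := M x)" for x by auto
  then show "linear (\<lambda>x. f (\<lambda>i. M ((V(j := x)) i)))"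
    using linear_compose[OF M alternating_form_linear[OF f j, of "\<lambda>i. M (V i)"]]
    by (simp add: o_def)
qed (auto intro: alternating_form_cong[OF f]
    simp: alternating_form_permute[OF f, of _ "\<lambda>i. M (_ i)"])

text \<open>
  The combination \<open>f(b) g - g(b) f\<close> vanishes on the basis \<open>b\<close>. When \<open>g\<close> is the pull-back of \<open>f\<close>
  under a linear map, the constant is the determinant of that map.
\<close>

lemma alternating_form_top_proportional:
  fixes f g :: "'v::euclidean_space form"
  assumes f: "alternating_form DIM('v) f" and g: "alternating_form DIM('v) g"
    and nz: "f V0 \<noteq> 0"
  obtains c where "\<And>V. g V = c * f V"
proof -
  obtain b where b: "bij_betw b {..<DIM('v)} (Basis :: 'v set)"
    using ex_bij_betw_nat_finite[of "Basis :: 'v set"] by (auto simp: atLeast0LessThan)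
  have vanish: "e b = 0 \<Longrightarrow> e W = 0" if "alternating_form DIM('v) e" for e W
    using alternating_form_eq_0[OF that b span_Basis] .
  have fb: "f b \<noteq> 0" using vanish[OF f] nz by blast
  have "f b * g V + (- g b) * f V = 0" for V
    using vanish[OF alternating_form_lincomb[OF g f, of "f b" "- g b"], of V] by simp
  then have "g V = g b / f b * f V" for V
    using fb by (simp add: field_simps)
  then show ?thesis using that by blast
qed

text \<open>
  Since \<open>P M = M Q\<close> with \<open>M\<close> invertible, \<open>P\<close> and \<open>Q\<close> have the same determinant and must scale
  \<open>f\<close> by the same factor; but the factors are \<open>-1\<close> and \<open>1\<close>.
\<close>

lemma alternating_form_top_eq_0_if_conjugate:
  fixes f :: "'v::euclidean_space form"
  assumes f: "alternating_form DIM('v) f" and M: "linear M" "surj M"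
    and conj: "\<And>v. P (M v) = M (Q v)"
    and P: "\<And>V. f (\<lambda>i. P (V i)) = - f V" and Q: "\<And>V. f (\<lambda>i. Q (V i)) = f V"
  shows "f V = 0"
proof (rule ccontr)
  assume "f V \<noteq> 0"
  then obtain c where c: "f (\<lambda>i. M (W i)) = c * f W" for W
    using alternating_form_top_proportional[OF f alternating_form_pullback[OF f M(1)]] by metis
  obtain M' where M': "M (M' v) = v" for v using M(2) by (metis surjD)
  have "f (\<lambda>i. M (W i)) = 0" for W
  proof -
    have "f (\<lambda>i. M (W i)) = f (\<lambda>i. M (Q (W i)))"
      using c[of W] c[of "\<lambda>i. Q (W i)"] Q[of W] by simp
    also have "\<dots> = - f (\<lambda>i. M (W i))" using P[of "\<lambda>i. M (W i)"] by (simp add: conj)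
    finally show ?thesis by simp
  qed
  from this[of "\<lambda>i. M' (V i)"] show False using \<open>f V \<noteq> 0\<close> by (simp add: M')
qed

text \<open>
  Precomposition with \<open>\<tau>\<close> only reindexes the sum over permutations, so this holds for arbitrary
  functions \<open>\<alpha>\<close> and \<open>\<beta>\<close>.
\<close>

lemma wedge_permute:
  assumes "\<tau> permutes {..<k + l}"
  shows "wedge k l \<alpha> \<beta> (\<lambda>i. V (\<tau> i)) = of_int (sign \<tau>) * wedge k l \<alpha> \<beta> V"
proof -
  let ?P = "{\<sigma>. \<sigma> permutes {..<k + l}}"
  define t where "t V \<sigma> = of_int (sign \<sigma>) * \<alpha> (\<lambda>i. V (\<sigma> i)) * \<beta> (\<lambda>i. V (\<sigma> (k + i)))"
    for V and \<sigma> :: "nat \<Rightarrow> nat"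
  have sg: "(of_int (sign \<sigma>) :: complex) = of_int (sign \<tau>) * of_int (sign (\<tau> \<circ> \<sigma>))"
    if "\<sigma> permutes {..<k + l}" for \<sigma>
    using that assms by (simp add: sign_compose permutes_imp_permutation[of "{..<k + l}"]
        flip: mult.assoc of_int_mult)
  have "(\<Sum>\<sigma>\<in>?P. t (\<lambda>i. V (\<tau> i)) \<sigma>) = (\<Sum>\<sigma>\<in>?P. of_int (sign \<tau>) * t V (\<tau> \<circ> \<sigma>))"
    by (intro sum.cong) (simp_all add: t_def sg)
  also have "\<dots> = of_int (sign \<tau>) * (\<Sum>\<sigma>\<in>?P. t V (\<tau> \<circ> \<sigma>))" by (simp add: sum_distrib_left)
  also have "(\<Sum>\<sigma>\<in>?P. t V (\<tau> \<circ> \<sigma>)) = (\<Sum>\<sigma>\<in>?P. t V \<sigma>)"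
    using setum_permutations_compose_left[OF assms, of "t V"] by simp
  finally show ?thesis by (simp add: wedge_def t_def)
qed

lemma multilinear_form_wedge:
  assumes \<alpha>: "multilinear_form k \<alpha>" and \<beta>: "multilinear_form l \<beta>"
  shows "multilinear_form (k + l) (wedge k l \<alpha> \<beta>)"
  unfolding multilinear_form_def
proof (intro conjI allI impI)
  fix V W :: "nat \<Rightarrow> 'a" assume VW: "\<forall>i<k + l. V i = W i"
  have "\<alpha> (\<lambda>i. V (\<sigma> i)) = \<alpha> (\<lambda>i. W (\<sigma> i))" "\<beta> (\<lambda>i. V (\<sigma> (k + i))) = \<beta> (\<lambda>i. W (\<sigma> (k + i)))"
    if "\<sigma> permutes {..<k + l}" for \<sigma>
    using VW permutes_in_image[OF that]
    by (auto intro!: multilinear_form_cong[OF \<alpha>] multilinear_form_cong[OF \<beta>])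
  then show "wedge k l \<alpha> \<beta> V = wedge k l \<alpha> \<beta> W"
    unfolding wedge_def by (intro arg_cong2[of _ _ _ _ "(/)"] sum.cong) auto
next
  fix V :: "nat \<Rightarrow> 'a" and j assume j: "j < k + l"
  have "linear (\<lambda>x. of_int (sign \<sigma>) * \<alpha> (\<lambda>i. (V(j := x)) (\<sigma> i)) * \<beta> (\<lambda>i. (V(j := x)) (\<sigma> (k + i))))"
    if \<sigma>: "\<sigma> permutes {..<k + l}" for \<sigma>
  proof -
    \<comment> \<open>The summand of \<open>\<sigma>\<close> sees the argument \<open>j\<close> only at position \<open>m\<close>, which belongs to \<open>\<alpha>\<close> or to \<open>\<beta>\<close>.\<close>
    define m where "m = inv \<sigma> j"
    have m: "\<sigma> i = j \<longleftrightarrow> i = m" for i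
      using permutes_inverses[OF \<sigma>] unfolding m_def by metis
    have "m < k + l" using permutes_in_image[OF \<sigma>, of m] j m[of m] by auto
    show ?thesis
    proof (cases "m < k")
      case True
      have "(\<lambda>i. (V(j := x)) (\<sigma> i)) = (\<lambda>i. V (\<sigma> i))(m := x)" for x
        using m by auto
      moreover have "(\<lambda>i. (V(j := x)) (\<sigma> (k + i))) = (\<lambda>i. V (\<sigma> (k + i)))" for x
        using m True by auto
      ultimately show ?thesis
        using multilinear_form_linear[OF \<alpha> True, of "\<lambda>i. V (\<sigma> i)"]
        by (simp add: linear_iff algebra_simps)
    next
      case False
      have "\<alpha> (\<lambda>i. (V(j := x)) (\<sigma> i)) = \<alpha> (\<lambda>i. V (\<sigma> i))" for x
        using m False by (intro multilinear_form_cong[OF \<alpha>]) auto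
      moreover have "(\<lambda>i. (V(j := x)) (\<sigma> (k + i))) = (\<lambda>i. V (\<sigma> (k + i)))(m - k := x)" for x
        using m False by (auto simp: fun_eq_iff)
      ultimately show ?thesis
        using multilinear_form_linear[OF \<beta>, of "m - k" "\<lambda>i. V (\<sigma> (k + i))"] \<open>m < k + l\<close> False
        by (simp add: linear_iff algebra_simps)
    qed
  qed
  then have "linear (\<lambda>x. \<Sum>\<sigma> | \<sigma> permutes {..<k + l}. of_int (sign \<sigma>) *
      \<alpha> (\<lambda>i. (V(j := x)) (\<sigma> i)) * \<beta> (\<lambda>i. (V(j := x)) (\<sigma> (k + i))))"
    by (intro linear_compose_sum) auto
  then show "linear (\<lambda>x. wedge k l \<alpha> \<beta> (V(j := x)))"
    unfolding wedge_def by (simp add: linear_iff add_divide_distrib scaleR_conv_of_real)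
qed

lemma alternating_form_wedge:
  "multilinear_form k \<alpha> \<Longrightarrow> multilinear_form l \<beta> \<Longrightarrow> alternating_form (k + l) (wedge k l \<alpha> \<beta>)"
  unfolding alternating_form_def using multilinear_form_wedge wedge_permute by blast

lemma multilinear_form_two_form:
  assumes "bilinear F"
  shows "multilinear_form 2 (two_form F)"
  using assms unfolding multilinear_form_def bilinear_def two_form_def
  by (auto simp: less_2_cases_iff)

lemma multilinear_form_wedge_power:
  assumes "multilinear_form 2 \<omega>"
  shows "multilinear_form (2 * m) (wedge_power \<omega> m)"
proof (induction m)
  case 0
  then show ?case by (simp add: multilinear_form_def)
next
  case (Suc m)
  then show ?case using multilinear_form_wedge[OF assms Suc] by simp
qed

lemma wedge_pullback:
  assumes "\<And>V. \<alpha> (\<lambda>i. M (V i)) = a * \<alpha> V" "\<And>V. \<beta> (\<lambda>i. M (V i)) = b * \<beta> V"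
  shows "wedge k l \<alpha> \<beta> (\<lambda>i. M (V i)) = a * b * wedge k l \<alpha> \<beta> V"
  by (simp add: wedge_def assms sum_distrib_left mult_ac)

lemma wedge_power_pullback:
  assumes "\<And>V. \<omega> (\<lambda>i. M (V i)) = a * \<omega> V"
  shows "wedge_power \<omega> m (\<lambda>i. M (V i)) = a ^ m * wedge_power \<omega> m V"
proof (induction m arbitrary: V)
  case (Suc m)
  then show ?case using wedge_pullback[of \<omega> M a, OF assms] by simp
qed simp

section \<open>Forms of type (1,1) for all three complex structures are primitive\<close>

lemma linear_cx: "linear cxI" "linear cxJ" "linear cxK"
  by (auto simp: linear_iff cxI_def cxJ_def cxK_def prod_eq_iff intro!: base_eqI)

lemma hyperkaehler_anticommute:
  "cxJ (cxI v) = - cxI (cxJ v)" "cxK (cxJ v) = - cxJ (cxK v)" "cxI (cxK v) = - cxK (cxI v)"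
  by (cases v; auto simp: cxI_def cxJ_def cxK_def intro!: base_eqI)+

lemma hyperkaehler_orthogonal:
  "cxI v \<bullet> cxI w = v \<bullet> w" "cxJ v \<bullet> cxJ w = v \<bullet> w" "cxK v \<bullet> cxK w = v \<bullet> w"
  by (cases v; cases w;
      simp add: cxI_def cxJ_def cxK_def inner_base add_ac flip: sum.distrib)+

text \<open>
  The structures \<open>L\<close> and \<open>M\<close> are conjugate through \<open>L + M\<close>, because \<open>M (L + M) = M L - 1\<close> and
  \<open>(L + M) L = M L - 1\<close>. The form \<open>\<omega>\<^sub>L(v, w) = L v \<bullet> w\<close> satisfies
  \<open>\<omega>\<^sub>L(M v, M w) = L M v \<bullet> M w = - M L v \<bullet> M w = - \<omega>\<^sub>L(v, w)\<close>, and its power is odd.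
\<close>

lemma wedge_kform_power_eq_0:
  fixes L M :: "'n::finite tangent \<Rightarrow> 'n tangent"
  assumes F: "bilinear F" "\<And>v w. F (L v) (L w) = F v w" "\<And>v w. F (M v) (M w) = F v w"
    and lin: "linear L" "linear M"
    and LL: "\<And>v. L (L v) = - v" and MM: "\<And>v. M (M v) = - v"
    and anti: "\<And>v. M (L v) = - L (M v)"
    and orth: "\<And>v w. L v \<bullet> L w = v \<bullet> w" "\<And>v w. M v \<bullet> M w = v \<bullet> w"
  shows "wedge 2 (2 * (2 * CARD('n) - 1)) (two_form F)
    (wedge_power (two_form (\<lambda>v w. of_real (kform L v w))) (2 * CARD('n) - 1)) = (\<lambda>V. 0)"
proof
  fix V :: "nat \<Rightarrow> 'n tangent"
  let ?m = "2 * CARD('n) - 1"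
  define \<omega> :: "'n tangent form" where "\<omega> = two_form (\<lambda>v w. of_real (kform L v w))"
  define \<eta> where "\<eta> = wedge 2 (2 * ?m) (two_form F) (wedge_power \<omega> ?m)"
  have dim: "2 + 2 * ?m = DIM('n tangent)"
    using zero_less_card_finite[where 'a='n] by (simp del: zero_less_card_finite)
  have "bilinear (\<lambda>v w. complex_of_real (kform L v w))"
    using lin(1) by (simp add: bilinear_def linear_iff kform_def inner_simps scaleR_conv_of_real)
  then have "alternating_form (2 + 2 * ?m) \<eta>"
    unfolding \<eta>_def \<omega>_def
    by (intro alternating_form_wedge multilinear_form_wedge_power multilinear_form_two_form F(1))
  then have alt: "alternating_form DIM('n tangent) \<eta>" unfolding dim .
  have pull: "\<eta> (\<lambda>i. C (V i)) = a ^ ?m * \<eta> V"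
    if "\<And>v w. F (C v) (C w) = F v w" "\<And>v w. kform L (C v) (C w) = a * kform L v w"
    for C a V
    using wedge_pullback[of "two_form F" C 1 "wedge_power \<omega> ?m" "of_real a ^ ?m" 2 "2 * ?m" V]
      wedge_power_pullback[of \<omega> C "of_real a" ?m] that
    unfolding \<eta>_def by (simp add: \<omega>_def two_form_def)
  have "\<eta> V = 0"
  proof (rule alternating_form_top_eq_0_if_conjugate[OF alt])
    show "linear (\<lambda>v. L v + M v)" using lin by (rule linear_compose_add)
    \<comment> \<open>Anticommutation gives \<open>(L + M)\<^sup>2 = - 2\<close>, whence the inverse.\<close>
    have sq: "L (L v + M v) + M (L v + M v) = (-2) *\<^sub>R v" for v
      using LL MM anti lin by (simp add: linear_add scaleR_2)
    have "L (c *\<^sub>R (L v + M v)) + M (c *\<^sub>R (L v + M v)) =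
        c *\<^sub>R (L (L v + M v) + M (L v + M v))" for c v
      by (rule linear_scale[OF linear_compose_add[OF lin]])
    then have "L ((-1/2) *\<^sub>R (L v + M v)) + M ((-1/2) *\<^sub>R (L v + M v)) = v" for v
      by (simp only: sq) simp
    then show "surj (\<lambda>v. L v + M v)" by (rule surjI)
    show "M (L v + M v) = L (L v) + M (L v)" for v
      using LL MM lin by (simp add: linear_add)
    show "\<eta> (\<lambda>i. M (V i)) = - \<eta> V" for V
    proof -
      have "L (M v) \<bullet> M w = - (L v \<bullet> w)" for v w
        using orth(2)[of "L v" w] anti[of v] by simp
      then have "\<eta> (\<lambda>i. M (V i)) = of_real (-1) ^ ?m * \<eta> V"
        by (intro pull F(3)) (simp add: kform_def)
      moreover have "odd ?m" using zero_less_card_finite[where 'a='n] by simp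
      ultimately show ?thesis by simp
    qed
    show "\<eta> (\<lambda>i. L (V i)) = \<eta> V" for V
      using pull[of L 1 V] F(2) orth(1) by (simp add: kform_def)
  qed
  then show "wedge 2 (2 * ?m) (two_form F)
      (wedge_power (two_form (\<lambda>v w. of_real (kform L v w))) ?m) V = 0"
    unfolding \<eta>_def \<omega>_def .
qed

section \<open>Linear algebra of the curvature\<close>

text \<open>
  For \<open>A\<close> the derivative of \<open>f\<close> this is the curvature of the transform divided by \<open>i\<close>, the form
  \<open>\<Sum>\<^sub>a df\<^sup>a \<and> du\<^sup>a + dg\<^sup>a \<and> dv\<^sup>a\<close> when \<open>f\<close> has components \<open>f\<^sup>a\<close>, \<open>g\<^sup>a\<close>.
\<close>

definition twisted_pairing :: "('n::finite base \<Rightarrow> 'n base) \<Rightarrow> 'n tangent \<Rightarrow> 'n tangent \<Rightarrow> real"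
  where "twisted_pairing A v w = A (fst v) \<bullet> snd w - A (fst w) \<bullet> snd v"

lemma bilinear_twisted_pairing:
  assumes "linear A"
  shows "bilinear (twisted_pairing A)"
  using assms by (auto simp: bilinear_def linear_iff twisted_pairing_def inner_simps algebra_simps)

text \<open>
  Testing invariance on \<open>(p, 0)\<close> and \<open>(0, - R z)\<close> turns it into \<open>A (R p) \<bullet> z = R (A p) \<bullet> z\<close>.
\<close>

lemma twisted_pairing_invariant_iff_commute:
  assumes C: "\<And>v. C v = (R (fst v), R (snd v))"
    and R: "linear R" "\<And>p q. R p \<bullet> R q = p \<bullet> q" "\<And>p. R (R p) = - p"
    and A: "linear A"
  shows "(\<forall>v w. twisted_pairing A (C v) (C w) = twisted_pairing A v w) \<longleftrightarrow>
    (\<forall>p. A (R p) = R (A p))"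
proof
  assume inv: "\<forall>v w. twisted_pairing A (C v) (C w) = twisted_pairing A v w"
  show "\<forall>p. A (R p) = R (A p)"
  proof
    fix p
    have "A (R p) \<bullet> z = R (A p) \<bullet> z" for z
      using inv[rule_format, of "(p, 0)" "(0, - R z)"] R(2)[of "A p" "R z"] R(3) A R(1)
      by (simp add: twisted_pairing_def C linear_0 linear_neg)
    then show "A (R p) = R (A p)" by (metis vector_eq_rdot)
  qed
next
  assume "\<forall>p. A (R p) = R (A p)"
  then show "\<forall>v w. twisted_pairing A (C v) (C w) = twisted_pairing A v w"
    using R(2) by (simp add: twisted_pairing_def C)
qed

text \<open>
  Both sides say that \<open>S A\<close> is symmetric: \<open>A p \<bullet> S p' = A p' \<bullet> S p\<close>. On the left this is
  invariance tested on \<open>(p, 0)\<close> and \<open>(0, S p')\<close>.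
\<close>

lemma twisted_pairing_invariant_iff_isotropic:
  assumes C: "\<And>v. C v = (- S (snd v), S (fst v))"
    and S: "linear S" "\<And>p q. S p \<bullet> q = p \<bullet> S q" "\<And>p. S (S p) = p"
    and A: "linear A"
  shows "(\<forall>v w. twisted_pairing A (C v) (C w) = twisted_pairing A v w) \<longleftrightarrow>
    (\<forall>p p'. kform C (p, A p) (p', A p') = 0)"
proof -
  have k: "kform C (p, A p) (p', A p') = A p' \<bullet> S p - A p \<bullet> S p'" for p p'
    using S(2)[of "A p" p'] by (simp add: kform_def C inner_commute)
  show ?thesis
  proof
    assume inv: "\<forall>v w. twisted_pairing A (C v) (C w) = twisted_pairing A v w"
    show "\<forall>p p'. kform C (p, A p) (p', A p') = 0"
    proof (intro allI)
      fix p p'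
      show "kform C (p, A p) (p', A p') = 0"
        using inv[rule_format, of "(p, 0)" "(0, S p')"] A S
        by (simp add: k twisted_pairing_def C linear_0 linear_neg)
    qed
  next
    assume "\<forall>p p'. kform C (p, A p) (p', A p') = 0"
    then have sym: "A p' \<bullet> S p = A p \<bullet> S p'" for p p' by (simp add: k)
    have "A (S q) \<bullet> S p = A p \<bullet> q" for p q
      using sym[of p "S q"] S(3) by simp
    then show "\<forall>v w. twisted_pairing A (C v) (C w) = twisted_pairing A v w"
      using A by (simp add: twisted_pairing_def C linear_neg)
  qed
qed

lemma twisted_pairing_cxI_iff:
  fixes A :: "'n::finite base \<Rightarrow> 'n base"
  assumes "linear A"
  shows "(\<forall>v w. twisted_pairing A (cxI v) (cxI w) = twisted_pairing A v w) \<longleftrightarrow>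
    (\<forall>p. \<exists>p'. cxI (p, A p) = (p', A p'))"
proof -
  define R :: "'n base \<Rightarrow> 'n base" where "R p = mkvec (\<lambda>a. - p $ Inr a) (\<lambda>a. p $ Inl a)" for p
  have C: "cxI v = (R (fst v), R (snd v))" for v :: "'n tangent"
    by (simp add: cxI_def R_def split: prod.split)
  have "linear R" "R p \<bullet> R q = p \<bullet> q" "R (R p) = - p" for p q
    by (auto simp: R_def linear_iff inner_base add.commute intro!: base_eqI)
  from twisted_pairing_invariant_iff_commute[OF C this assms] show ?thesis
    by (auto simp: C)
qed

lemma twisted_pairing_cxJ_iff:
  fixes A :: "'n::finite base \<Rightarrow> 'n base"
  assumes "linear A"
  shows "(\<forall>v w. twisted_pairing A (cxJ v) (cxJ w) = twisted_pairing A v w) \<longleftrightarrow>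
    (\<forall>p p'. kform cxJ (p, A p) (p', A p') = 0)"
proof -
  define S :: "'n base \<Rightarrow> 'n base" where "S p = mkvec (\<lambda>a. p $ Inl a) (\<lambda>a. - p $ Inr a)" for p
  have C: "cxJ v = (- S (snd v), S (fst v))" for v :: "'n tangent"
    by (cases v) (auto simp: cxJ_def S_def intro!: base_eqI)
  have "linear S" "S p \<bullet> q = p \<bullet> S q" "S (S p) = p" for p q
    by (auto simp: S_def linear_iff inner_base intro!: base_eqI)
  from twisted_pairing_invariant_iff_isotropic[OF C this assms] show ?thesis .
qed

lemma twisted_pairing_cxK_iff:
  fixes A :: "'n::finite base \<Rightarrow> 'n base"
  assumes "linear A"
  shows "(\<forall>v w. twisted_pairing A (cxK v) (cxK w) = twisted_pairing A v w) \<longleftrightarrow>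
    (\<forall>p p'. kform cxK (p, A p) (p', A p') = 0)"
proof -
  define S :: "'n base \<Rightarrow> 'n base" where "S p = mkvec (\<lambda>a. p $ Inr a) (\<lambda>a. p $ Inl a)" for p
  have C: "cxK v = (- S (snd v), S (fst v))" for v :: "'n tangent"
    by (cases v) (auto simp: cxK_def S_def intro!: base_eqI)
  have "linear S" "S p \<bullet> q = p \<bullet> S q" "S (S p) = p" for p q
    by (auto simp: S_def linear_iff inner_base add.commute intro!: base_eqI)
  from twisted_pairing_invariant_iff_isotropic[OF C this assms] show ?thesis .
qed

text \<open>
  Up to constant factors, the imaginary part of the (0,2) component of \<open>i G\<close> is
  \<open>G(v, w) - G(L v, L w)\<close>, and the real part is \<open>G(L v, w) + G(v, L w)\<close>, which vanishes along
  with the imaginary part because \<open>L\<^sup>2 = - 1\<close>.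
\<close>

lemma component02_imaginary_eq_0_iff:
  assumes "bilinear G" and L: "\<And>v. L (L v) = - v"
  shows "component02 L (\<lambda>v w. \<i> * of_real (G v w)) = (\<lambda>v w. 0) \<longleftrightarrow>
    (\<forall>v w. G (L v) (L w) = G v w)"
proof
  assume *: "component02 L (\<lambda>v w. \<i> * of_real (G v w)) = (\<lambda>v w. 0)"
  show "\<forall>v w. G (L v) (L w) = G v w"
  proof (intro allI)
    fix v w
    show "G (L v) (L w) = G v w"
      using fun_cong[OF fun_cong[OF *], of v w] by (simp add: component02_def complex_eq_iff)
  qed
next
  assume inv: "\<forall>v w. G (L v) (L w) = G v w"
  have "G (L v) w = - G v (L w)" for v w
    using inv[rule_format, of v "L w"] L bilinear_rneg[OF assms(1)] by simp
  then show "component02 L (\<lambda>v w. \<i> * of_real (G v w)) = (\<lambda>v w. 0)"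
    using inv by (simp add: component02_def fun_eq_iff L bilinear_rneg[OF assms(1)])
qed

section \<open>The graph as a submanifold\<close>

definition local_lift ::
    "'n::finite base set \<Rightarrow> ('n base \<Rightarrow> ('n + 'n) torus) \<Rightarrow> 'n base set \<Rightarrow> ('n base \<Rightarrow> 'n base) \<Rightarrow> bool"
  where "local_lift B h U f \<longleftrightarrow>
    open U \<and> U \<subseteq> B \<and> smooth_on U f \<and> (\<forall>x\<in>U. h x = torus_of (f x))"

lemma local_lift_exists:
  assumes "torus_smooth_on B h" "x \<in> B"
  obtains U f where "local_lift B h U f" "x \<in> U"
  using assms unfolding torus_smooth_on_def local_lift_def by metis

lemma local_lift_has_derivative:
  "local_lift B h U f \<Longrightarrow> x \<in> U \<Longrightarrow> (f has_derivative frechet_derivative f (at x)) (at x)"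
  unfolding local_lift_def by (blast intro: smooth_on_has_derivative)

lemma local_lift_linear:
  "local_lift B h U f \<Longrightarrow> x \<in> U \<Longrightarrow> linear (frechet_derivative f (at x))"
  by (rule has_derivative_linear[OF local_lift_has_derivative])

lemma period_lattice_diff:
  "k \<in> period_lattice \<Longrightarrow> k' \<in> period_lattice \<Longrightarrow> k - k' \<in> period_lattice"
  by (simp add: period_lattice_iff diff_divide_distrib Ints_diff)

text \<open>
  The lattice is discrete. This is why two lifts differ by a local constant, and why the torus
  component of a curve in the graph follows a single lift up to a constant.
\<close>

lemma eventually_constant_in_period_lattice:
  fixes g :: "'a::t2_space \<Rightarrow> real^'m::finite"
  assumes "isCont g z" "\<forall>\<^sub>F y in nhds z. g y \<in> period_lattice"
  shows "\<forall>\<^sub>F y in nhds z. g y = g z"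
proof -
  have "\<forall>\<^sub>F y in nhds z. dist (g y) (g z) < 2"
    using assms(1) by (intro tendstoD) (simp_all add: continuous_at tendsto_at_iff_tendsto_nhds)
  then show ?thesis
    using assms(2)
  proof eventually_elim
    case (elim y)
    have "g z \<in> period_lattice" using assms(2) by (rule eventually_nhds_x_imp_x)
    then have "g y - g z = 0"
      using elim by (intro period_lattice_small period_lattice_diff) (auto simp: dist_norm)
    then show ?case by simp
  qed
qed

text \<open>
  Along a curve \<open>c\<close> in the graph, \<open>snd (c t) - f (fst (c t))\<close> takes values in the period lattice
  for small \<open>t\<close>, hence is constant near \<open>0\<close> and has derivative zero there.
\<close>

lemma tangent_space_graph_subset:
  assumes lift: "local_lift B h U f" and x: "x \<in> U"
    and w: "w \<in> tangent_space (graph_on B h) (x, h x)"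
  shows "snd w = frechet_derivative f (at x) (fst w)"
proof -
  let ?A = "frechet_derivative f (at x)"
  obtain c \<epsilon> where "\<epsilon> > 0" and c0: "cov (c 0) = (x, h x)"
    and c: "\<And>t. t \<in> {-\<epsilon><..<\<epsilon>} \<Longrightarrow> cov (c t) \<in> graph_on B h"
    and D: "(c has_vector_derivative w) (at (0::real))"
    using w unfolding tangent_space_def by blast
  have x0: "fst (c 0) = x" using c0 by (simp add: cov_def)
  define g where "g t = snd (c t) - f (fst (c t))" for t
  have Dc: "(c has_derivative (\<lambda>t. t *\<^sub>R w)) (at 0)"
    using D by (simp add: has_vector_derivative_def)
  have Dfst: "((\<lambda>t. fst (c t)) has_derivative (\<lambda>t. fst (t *\<^sub>R w))) (at 0)"
    using Dc by (rule has_derivative_fst)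
  have "(f has_derivative ?A) (at (fst (c 0)))"
    using local_lift_has_derivative[OF lift x] by (simp add: x0)
  then have "((\<lambda>t. f (fst (c t))) has_derivative (\<lambda>t. ?A (fst (t *\<^sub>R w)))) (at 0)"
    by (rule has_derivative_compose[OF Dfst])
  then have Dg: "(g has_derivative (\<lambda>t. snd (t *\<^sub>R w) - ?A (fst (t *\<^sub>R w)))) (at 0)"
    unfolding g_def by (intro has_derivative_diff has_derivative_snd Dc)
  have "\<forall>\<^sub>F t in nhds 0. t \<in> {-\<epsilon><..<\<epsilon>}"
    using \<open>\<epsilon> > 0\<close> by (intro eventually_nhds_in_open) auto
  moreover have "\<forall>\<^sub>F t in nhds 0. fst (c t) \<in> U"
  proof -
    have "((\<lambda>t. fst (c t)) \<longlongrightarrow> x) (nhds 0)"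
      using has_derivative_continuous[OF Dfst] by (simp add: continuous_at tendsto_nhds_iff x0)
    then show ?thesis
      using lift x unfolding local_lift_def by (intro topological_tendstoD) auto
  qed
  ultimately have "\<forall>\<^sub>F t in nhds 0. g t \<in> period_lattice"
  proof eventually_elim
    case (elim t)
    then have "torus_of (snd (c t)) = torus_of (f (fst (c t)))"
      using c[of t] lift by (auto simp: cov_def graph_on_def local_lift_def)
    then show ?case by (simp add: torus_of_eq_iff g_def)
  qed
  then have "\<forall>\<^sub>F t in at 0. g t = g 0"
    using eventually_constant_in_period_lattice[OF has_derivative_continuous[OF Dg]]
    by (simp add: eventually_at_filter eventually_mono)
  then have "((\<lambda>t. g 0) has_derivative (\<lambda>t. snd (t *\<^sub>R w) - ?A (fst (t *\<^sub>R w)))) (at 0)"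
    by (intro has_derivative_transform_eventually[OF Dg]) auto
  from has_derivative_unique[OF this has_derivative_const] show ?thesis
    by (metis (no_types, lifting) eq_iff_diff_eq_0 scaleR_one)
qed

lemma bounded_linear_Pair_0: "bounded_linear (\<lambda>u. (0, u))"
  by (intro bounded_linear_Pair bounded_linear_zero bounded_linear_ident)

lemma tangent_space_graph_superset:
  assumes lift: "local_lift B h U f" and x: "x \<in> U"
  shows "(p, frechet_derivative f (at x) p) \<in> tangent_space (graph_on B h) (x, h x)"
proof -
  let ?A = "frechet_derivative f (at x)"
  define c where "c t = ((x, 0) + t *\<^sub>R (p, 0)) + (0, f (x + t *\<^sub>R p))" for t :: real
  have U: "open U" "U \<subseteq> B" "smooth_on U f" "\<And>z. z \<in> U \<Longrightarrow> h z = torus_of (f z)"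
    using lift unfolding local_lift_def by auto
  have "open ((\<lambda>t. x + t *\<^sub>R p) -` U)"
    using U(1) by (intro open_vimage continuous_intros)
  moreover have "0 \<in> (\<lambda>t. x + t *\<^sub>R p) -` U" using x by simp
  ultimately obtain \<epsilon> where \<epsilon>: "\<epsilon> > 0" "ball 0 \<epsilon> \<subseteq> (\<lambda>t. x + t *\<^sub>R p) -` U"
    by (meson openE)
  have in_U: "x + t *\<^sub>R p \<in> U" if "t \<in> {-\<epsilon><..<\<epsilon>}" for t
  proof -
    have "t \<in> ball 0 \<epsilon>" using that by auto
    then show ?thesis using \<epsilon>(2) by blast
  qed
  have "smooth_on {-\<epsilon><..<\<epsilon>} c"
    unfolding c_def using U(1,3) in_U
    by (intro smooth_on_add smooth_on_affine
        smooth_on_affine_compose[where L = "\<lambda>u. (0, u)", OF U(3,1)]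
        bounded_linear_Pair_0 bounded_linear_scaleR_left) auto
  moreover have "cov (c 0) = (x, h x)" using U(4) x by (simp add: c_def cov_def)
  moreover have "\<forall>t\<in>{-\<epsilon><..<\<epsilon>}. cov (c t) \<in> graph_on B h"
    using in_U U(2,4) by (auto simp: c_def cov_def graph_on_def)
  moreover have "(c has_vector_derivative (p, ?A p)) (at 0)"
  proof -
    have "((\<lambda>t. x + t *\<^sub>R p) has_derivative (\<lambda>t. t *\<^sub>R p)) (at 0)"
      by (auto intro!: derivative_eq_intros)
    moreover have "(f has_derivative ?A) (at (x + 0 *\<^sub>R p))"
      using local_lift_has_derivative[OF lift x] by simp
    ultimately have "((\<lambda>t. f (x + t *\<^sub>R p)) has_derivative (\<lambda>t. ?A (t *\<^sub>R p))) (at 0)"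
      by (rule has_derivative_compose)
    then have "(c has_derivative (\<lambda>t. t *\<^sub>R (p, 0) + (0, ?A (t *\<^sub>R p)))) (at 0)"
      unfolding c_def by (auto intro!: derivative_eq_intros)
    then show ?thesis
      using local_lift_linear[OF lift x] by (simp add: has_vector_derivative_def linear_scale)
  qed
  ultimately show ?thesis using \<epsilon>(1) unfolding tangent_space_def by blast
qed

lemma tangent_space_graph:
  assumes "local_lift B h U f" "x \<in> U"
  shows "tangent_space (graph_on B h) (x, h x) =
    {(p, frechet_derivative f (at x) p) | p. True}"
proof (intro equalityI subsetI)
  fix w assume "w \<in> tangent_space (graph_on B h) (x, h x)"
  then show "w \<in> {(p, frechet_derivative f (at x) p) | p. True}"
    using tangent_space_graph_subset[OF assms] by (cases w) force
qed (use tangent_space_graph_superset[OF assms] in auto)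

text \<open>
  The slice chart is the shear \<open>(x, u) \<mapsto> (x, u - f x)\<close>, which flattens the graph of a lift. It is
  used on a neighbourhood whose second factor is a ball of radius 1: by \<open>period_lattice_small\<close>
  two points of the ball with the same image in the torus are equal, so that the graph
  of \<open>h\<close> meets the neighbourhood only in the graph of this one lift.
\<close>

lemma submanifold_graph:
  fixes B :: "'n::finite base set"
  assumes "torus_smooth_on B h"
  shows "submanifold (2 * CARD('n)) (graph_on B h)"
  unfolding submanifold_def
proof
  fix p assume "p \<in> graph_on B h"
  then obtain x where x: "x \<in> B" "p = (x, h x)" by (auto simp: graph_on_def)
  obtain U f where lift: "local_lift B h U f" and "x \<in> U"
    using local_lift_exists[OF assms x(1)] .
  have U: "open U" "U \<subseteq> B" "smooth_on U f" "\<And>z. z \<in> U \<Longrightarrow> h z = torus_of (f z)"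
    using lift unfolding local_lift_def by auto
  define U' where "U' = U \<inter> f -` ball (f x) 1"
  have "open U'"
    unfolding U'_def using smooth_on_continuous_on[OF U(3)] U(1)
    by (simp add: continuous_open_preimage)
  define N :: "'n tangent set" where "N = U' \<times> ball (f x) 1"
  \<comment> \<open>The zeros give the summands the form required by the smoothness rules for affine maps.\<close>
  define \<phi> :: "'n tangent \<Rightarrow> 'n tangent" where "\<phi> q = (0 + q) + (0, - f (0 + fst q))" for q
  define \<psi> :: "'n tangent \<Rightarrow> 'n tangent" where "\<psi> q = (0 + q) + (0, f (0 + fst q))" for q
  define E :: "'n tangent set" where "E = UNIV \<times> {0}"
  have small: "u = u'"
    if "u \<in> ball (f x) 1" "u' \<in> ball (f x) 1" "torus_of u = torus_of u'" for u u'
  proof -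
    have "dist u u' < 2"
      using that(1,2) dist_triangle2[of u u' "f x"] by (auto simp: dist_commute)
    then show ?thesis
      using that(3) period_lattice_small[of "u - u'"] by (simp add: dist_norm torus_of_eq_iff)
  qed
  have N: "open N" unfolding N_def using \<open>open U'\<close> by (simp add: open_Times)
  have image: "\<phi> ` N = (U' \<times> UNIV) \<inter> \<psi> -` N"
  proof (intro equalityI subsetI)
    fix q assume "q \<in> (U' \<times> UNIV) \<inter> \<psi> -` N"
    moreover have "\<phi> (\<psi> q) = q" by (cases q) (simp add: \<phi>_def \<psi>_def)
    ultimately show "q \<in> \<phi> ` N" by (metis IntD2 image_eqI vimageD)
  qed (auto simp: \<phi>_def \<psi>_def N_def)
  have \<psi>: "smooth_on (U' \<times> UNIV) \<psi>"
    unfolding \<psi>_def using U(1) \<open>open U'\<close>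
    by (intro smooth_on_add smooth_on_affine smooth_on_affine_compose[where L = "\<lambda>u. (0, u)", OF U(3,1)]
        bounded_linear_Pair_0 bounded_linear_ident bounded_linear_fst open_Times)
      (auto simp: U'_def)
  have im_open: "open (\<phi> ` N)"
    unfolding image using smooth_on_continuous_on[OF \<psi>] \<open>open U'\<close> N
    by (intro continuous_open_preimage) (auto simp: open_Times)
  have "p \<in> cov ` N"
    using x U(4) \<open>x \<in> U\<close> by (intro image_eqI[of _ _ "(x, f x)"]) (auto simp: N_def U'_def cov_def)
  moreover have "inj_on cov N"
    by (rule inj_onI) (auto simp: N_def cov_def intro: small)
  moreover have "smooth_on N \<phi>"
    unfolding \<phi>_def using N
    by (intro smooth_on_add smooth_on_affine
        smooth_on_affine_compose[where L = "\<lambda>u. (0, - u)", OF U(3,1)]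
        bounded_linear_Pair bounded_linear_zero bounded_linear_minus
        bounded_linear_ident bounded_linear_fst)
      (auto simp: N_def U'_def)
  moreover have "smooth_on (\<phi> ` N) \<psi>"
    unfolding smooth_on_def
  proof
    fix k
    have "Ck_on k (\<phi> ` N) (\<lambda>q. id (\<psi> (0 + id q)))"
      using \<psi> im_open \<open>open U'\<close> unfolding smooth_on_def
      by (intro Ck_on_affine_compose[of _ _ "U' \<times> UNIV"])
        (auto simp: image id_def open_Times bounded_linear_ident)
    then show "Ck_on k (\<phi> ` N) \<psi>" by simp
  qed
  moreover have "\<forall>q\<in>N. \<psi> (\<phi> q) = q" by (simp add: \<phi>_def \<psi>_def prod_eq_iff)
  moreover have "subspace E"
    unfolding E_def by (intro subspace_Times) auto
  moreover have "dim E = 2 * CARD('n)"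
    unfolding E_def by (subst dim_Times) (auto simp: dim_UNIV)
  moreover have "\<phi> ` (N \<inter> cov -` graph_on B h) = \<phi> ` N \<inter> E"
  proof -
    have "q \<in> cov -` graph_on B h \<longleftrightarrow> \<phi> q \<in> E" if "q \<in> N" for q
    proof -
      have q: "fst q \<in> U" "f (fst q) \<in> ball (f x) 1" "snd q \<in> ball (f x) 1"
        using that by (auto simp: N_def U'_def)
      have "q \<in> cov -` graph_on B h \<longleftrightarrow> torus_of (snd q) = torus_of (f (fst q))"
        using q(1) U(2,4) by (auto simp: graph_on_def cov_def)
      also have "\<dots> \<longleftrightarrow> snd q = f (fst q)" using small[OF q(3,2)] by auto
      finally show ?thesis by (cases q) (auto simp: \<phi>_def E_def)
    qed
    then show ?thesis by blast
  qed
  ultimately show "\<exists>(N :: 'n tangent set) (\<phi> :: 'n tangent \<Rightarrow> 'n tangent) \<psi> E.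
       open N \<and> p \<in> cov ` N \<and> inj_on cov N \<and>
       smooth_on N \<phi> \<and> open (\<phi> ` N) \<and> smooth_on (\<phi> ` N) \<psi> \<and> (\<forall>q\<in>N. \<psi> (\<phi> q) = q) \<and>
       subspace E \<and> dim E = 2 * CARD('n) \<and> \<phi> ` (N \<inter> cov -` graph_on B h) = \<phi> ` N \<inter> E"
    using N im_open by (intro exI conjI)
qed

lemma complex_lagrangian_graph_iff:
  fixes B :: "'n::finite base set"
  assumes h: "torus_smooth_on B h"
  shows "complex_lagrangian (B \<times> UNIV) (graph_on B h) \<longleftrightarrow>
    (\<forall>U f x. local_lift B h U f \<and> x \<in> U \<longrightarrow> (let A = frechet_derivative f (at x) in
      (\<forall>p. \<exists>p'. cxI (p, A p) = (p', A p')) \<and>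
      (\<forall>p p'. kform cxJ (p, A p) (p', A p') = 0) \<and>
      (\<forall>p p'. kform cxK (p, A p) (p', A p') = 0)))" (is "_ \<longleftrightarrow> ?R")
proof -
  define T where "T x = tangent_space (graph_on B h) (x, h x)" for x
  have "complex_lagrangian (B \<times> UNIV) (graph_on B h) \<longleftrightarrow>
    (\<forall>x\<in>B. (\<forall>w\<in>T x. cxI w \<in> T x) \<and> (\<forall>w\<in>T x. \<forall>w'\<in>T x. kform cxJ w w' = 0) \<and>
      (\<forall>w\<in>T x. \<forall>w'\<in>T x. kform cxK w w' = 0))"
    using submanifold_graph[OF h]
    by (auto simp: complex_lagrangian_def complex_submanifold_def lagrangian_def T_def graph_on_def)
  also have "\<dots> \<longleftrightarrow> (\<forall>U f x. local_lift B h U f \<and> x \<in> U \<longrightarrow>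
      (\<forall>w\<in>T x. cxI w \<in> T x) \<and> (\<forall>w\<in>T x. \<forall>w'\<in>T x. kform cxJ w w' = 0) \<and>
      (\<forall>w\<in>T x. \<forall>w'\<in>T x. kform cxK w w' = 0))" (is "(\<forall>x\<in>B. ?Q x) \<longleftrightarrow> _")
  proof
    assume "\<forall>x\<in>B. ?Q x"
    then show "\<forall>U f x. local_lift B h U f \<and> x \<in> U \<longrightarrow> ?Q x"
      unfolding local_lift_def by blast
  next
    assume "\<forall>U f x. local_lift B h U f \<and> x \<in> U \<longrightarrow> ?Q x"
    then show "\<forall>x\<in>B. ?Q x" using local_lift_exists[OF h] by metis
  qed
  also have "\<dots> \<longleftrightarrow> ?R"
  proof (intro all_cong1 imp_cong refl)
    fix U f x assume "local_lift B h U f \<and> x \<in> U"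
    then have T: "T x = {(p, frechet_derivative f (at x) p) | p. True}"
      unfolding T_def using tangent_space_graph by blast
    show "?Q x \<longleftrightarrow> (let A = frechet_derivative f (at x) in
      (\<forall>p. \<exists>p'. cxI (p, A p) = (p', A p')) \<and>
      (\<forall>p p'. kform cxJ (p, A p) (p', A p') = 0) \<and>
      (\<forall>p p'. kform cxK (p, A p) (p', A p') = 0))"
      unfolding T Let_def by auto
  qed
  finally show ?thesis .
qed

section \<open>The transform as a Hermitian connection\<close>

lemma fourier_mukai_patches:
  "patches (fourier_mukai B h) = {(U, f). local_lift B h U f}"
  "patch_dom (fourier_mukai B h) (U, f) = U \<times> UNIV"
  by (auto simp: fourier_mukai_def local_lift_def)

lemma fourier_mukai_conn_form:
  "conn_form (fourier_mukai B h) (U, f) p w = \<i> * of_real (f (fst p) \<bullet> snd w)"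
  by (simp add: fourier_mukai_def inner_base)

lemma fst_dcov [simp]: "fst (dcov q) = fst q"
  by (simp add: dcov_def)

lemma snd_dlift_dcov: "snd (dlift (dcov q)) - snd q \<in> dual_lattice"
proof -
  have "dual_torus_of (rep_dual_torus (dual_torus_of (snd q))) = dual_torus_of (snd q)"
    by (rule Quotient3_abs_rep[OF Quotient3_dual_torus])
  then show ?thesis by (simp add: dlift_def dcov_def dual_torus.abs_eq_iff)
qed

lemma cis_period_inner_dual_lattice:
  assumes "k \<in> period_lattice" "u - u' \<in> dual_lattice"
  shows "cis (k \<bullet> u) = cis (k \<bullet> u')"
proof -
  obtain j :: int where "(u - u') \<bullet> k = 2 * pi * of_int j"
    using assms unfolding dual_lattice_def by blast
  then have "k \<bullet> u = k \<bullet> u' + 2 * pi * of_int j"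
    by (simp add: inner_simps inner_commute algebra_simps)
  then show ?thesis by (simp add: cis_multiple_2pi flip: cis_mult)
qed

text \<open>
  On the overlap \<open>k = f' - f\<close> is a locally constant lattice vector, and for such \<open>k\<close> the
  character \<open>cis (k \<bullet> u)\<close> is independent of the chosen representative \<open>u\<close> of a point of the dual
  torus. So the transition function agrees near \<open>q\<close> with the smooth function \<open>cis (k \<bullet> u)\<close>.
\<close>

lemma fourier_mukai_transition_has_derivative:
  fixes B :: "'n::finite base set"
  assumes lift: "local_lift B h U f" and lift': "local_lift B h U' f'"
    and q: "fst q \<in> U" "fst q \<in> U'"
  shows "((\<lambda>q. cis ((f' (fst q) - f (fst q)) \<bullet> snd (dlift (dcov q)))) has_derivative
    (\<lambda>w. (\<i> * of_real (f' (fst q) \<bullet> snd w) - \<i> * of_real (f (fst q) \<bullet> snd w)) *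
      cis ((f' (fst q) - f (fst q)) \<bullet> snd (dlift (dcov q))))) (at q)"
proof -
  define g where "g y = f' (fst y) - f (fst y)" for y :: "'n tangent"
  have lattice: "g y \<in> period_lattice" if "fst y \<in> U" "fst y \<in> U'" for y
    using that lift lift' unfolding g_def local_lift_def torus_of_eq_iff[symmetric] by metis
  have "\<forall>\<^sub>F y in nhds q. y \<in> (U \<inter> U') \<times> UNIV"
    using lift lift' q unfolding local_lift_def
    by (intro eventually_nhds_in_open open_Times open_Int open_UNIV) (auto simp: mem_Times_iff)
  then have "\<forall>\<^sub>F y in nhds q. g y \<in> period_lattice"
    by eventually_elim (auto intro: lattice)
  moreover have "isCont g q"
    unfolding g_def using local_lift_has_derivative[OF lift q(1)] local_lift_has_derivative[OF lift' q(2)]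
    by (intro continuous_diff isCont_o2[OF isCont_fst[OF continuous_ident]] has_derivative_continuous)
  ultimately have "\<forall>\<^sub>F y in nhds q. g y = g q"
    by (intro eventually_constant_in_period_lattice)
  moreover have kq: "g q \<in> period_lattice" using lattice q by blast
  have cis: "cis (g q \<bullet> snd (dlift (dcov y))) = cis (g q \<bullet> snd y)" for y
    using kq snd_dlift_dcov by (rule cis_period_inner_dual_lattice)
  ultimately have ev: "\<forall>\<^sub>F y in nhds q. cis (g q \<bullet> snd y) = cis (g y \<bullet> snd (dlift (dcov y)))"
    by (auto elim!: eventually_mono)
  have "((\<lambda>y. cis (g q \<bullet> snd y)) has_derivative
      (\<lambda>w. (g q \<bullet> snd w) *\<^sub>R (\<i> * cis (g q \<bullet> snd q)))) (at q)"
    by (auto intro!: derivative_eq_intros)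
  then have D: "((\<lambda>y. cis (g y \<bullet> snd (dlift (dcov y)))) has_derivative
      (\<lambda>w. (g q \<bullet> snd w) *\<^sub>R (\<i> * cis (g q \<bullet> snd q)))) (at q)"
    using ev unfolding eventually_nhds_conv_at
    by (elim conjE) (rule has_derivative_transform_eventually, assumption+, rule UNIV_I)
  have eq: "(g q \<bullet> snd w) *\<^sub>R (\<i> * cis (g q \<bullet> snd q)) =
      (\<i> * of_real (f' (fst q) \<bullet> snd w) - \<i> * of_real (f (fst q) \<bullet> snd w)) *
      cis (g q \<bullet> snd (dlift (dcov q)))" for w
    unfolding cis by (simp add: g_def inner_diff_left scaleR_conv_of_real algebra_simps)
  show ?thesis using D unfolding eq unfolding g_def .
qed

lemma hermitian_connection_fourier_mukai:
  fixes B :: "'n::finite base set"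
  assumes h: "torus_smooth_on B h"
  shows "hermitian_connection (B \<times> UNIV) (fourier_mukai B h)"
proof -
  let ?D = "fourier_mukai B h"
  have vimage: "dcov -` (U \<times> UNIV) = U \<times> UNIV" for U :: "'n base set"
    by (auto simp: dcov_def)
  have tr: "transition ?D (U, f) (U', f') p = cis ((f' (fst p) - f (fst p)) \<bullet> snd (dlift p))"
    for U f U' f' p
    by (simp add: fourier_mukai_def)
  have cover: "(\<Union>i\<in>patches ?D. patch_dom ?D i) = B \<times> UNIV"
  proof (intro equalityI subsetI)
    fix p :: "'n dual_total" assume "p \<in> B \<times> UNIV"
    then obtain U f where "local_lift B h U f" "fst p \<in> U"
      using local_lift_exists[OF h, of "fst p"] by (auto simp: mem_Times_iff)
    then show "p \<in> (\<Union>i\<in>patches ?D. patch_dom ?D i)"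
      by (intro UN_I[of "(U, f)"]) (simp_all add: fourier_mukai_patches mem_Times_iff)
  qed (auto simp: fourier_mukai_patches local_lift_def)
  have smooth: "smooth_on (U \<times> UNIV) (\<lambda>q. conn_form ?D (U, f) (dcov q) w)"
    if "local_lift B h U f" for U f w
  proof -
    have "smooth_on (U \<times> UNIV) (\<lambda>q :: 'n tangent. \<i> * of_real (f (0 + fst q) \<bullet> snd w))"
      using that unfolding local_lift_def
      by (intro smooth_on_affine_compose[where L = "\<lambda>u. \<i> * of_real (u \<bullet> snd w)" and S = U]
          bounded_linear_fst bounded_linear_const_mult bounded_linear_inner_left
          bounded_linear_compose[OF bounded_linear_of_real])
        (auto simp: open_Times)
    then show ?thesis by (simp add: fourier_mukai_conn_form)
  qed
  have local_form: "open (dcov -` patch_dom ?D i) \<and>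
      (\<forall>p\<in>patch_dom ?D i. linear (conn_form ?D i p) \<and> (\<forall>w. Re (conn_form ?D i p w) = 0)) \<and>
      (\<forall>w. smooth_on (dcov -` patch_dom ?D i) (\<lambda>q. conn_form ?D i (dcov q) w))"
    if i_patch: "i \<in> patches ?D" for i
  proof -
    obtain U f where i: "i = (U, f)" and lift: "local_lift B h U f"
      using i_patch by (auto simp: fourier_mukai_patches)
    have "linear (\<lambda>w :: 'n tangent. \<i> * complex_of_real (f (fst p) \<bullet> snd w))" for p :: "'n dual_total"
    proof (rule linearI)
      fix c :: real and w :: "'n tangent"
      show "\<i> * complex_of_real (f (fst p) \<bullet> snd (c *\<^sub>R w)) =
          c *\<^sub>R (\<i> * complex_of_real (f (fst p) \<bullet> snd w))"
        by (simp add: scaleR_conv_of_real[where 'a = complex])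
    qed (simp add: inner_add_right distrib_left)
    moreover have "conn_form ?D i p = (\<lambda>w. \<i> * of_real (f (fst p) \<bullet> snd w))" for p
      by (simp add: i fourier_mukai_conn_form fun_eq_iff)
    moreover have "open (U \<times> UNIV :: 'n tangent set)"
      using lift by (simp add: local_lift_def open_Times)
    ultimately show ?thesis
      using smooth[OF lift] by (simp add: i fourier_mukai_patches vimage)
  qed
  have gauge: "(\<forall>p\<in>patch_dom ?D i \<inter> patch_dom ?D j. norm (transition ?D i j p) = 1) \<and>
      (\<forall>q\<in>dcov -` (patch_dom ?D i \<inter> patch_dom ?D j).
        ((\<lambda>q. transition ?D i j (dcov q)) has_derivative
         (\<lambda>w. (conn_form ?D j (dcov q) w - conn_form ?D i (dcov q) w) * transition ?D i j (dcov q)))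
        (at q))"
    if ij_patch: "i \<in> patches ?D" "j \<in> patches ?D" for i j
  proof -
    obtain U f U' f' where i: "i = (U, f)" "local_lift B h U f" and j: "j = (U', f')" "local_lift B h U' f'"
      using ij_patch by (auto simp: fourier_mukai_patches)
    show ?thesis
      using fourier_mukai_transition_has_derivative[OF i(2) j(2)]
      by (auto simp: i(1) j(1) tr fourier_mukai_patches fourier_mukai_conn_form mem_Times_iff)
  qed
  have cocycle: "transition ?D i j p * transition ?D j k p = transition ?D i k p" for i j k p
    by (cases i; cases j; cases k) (simp add: tr cis_mult flip: inner_add_left)
  show ?thesis
    unfolding hermitian_connection_def
    by (intro conjI, rule cover, rule ballI, erule local_form,
        intro ballI, erule (1) gauge, intro ballI, rule cocycle)
qed

section \<open>The instanton equations for the transform\<close>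

lemma fourier_mukai_curvature:
  assumes lift: "local_lift B h U f" and p: "fst p \<in> U"
  shows "curvature (fourier_mukai B h) (U, f) p =
    (\<lambda>v w. \<i> * of_real (twisted_pairing (frechet_derivative f (at (fst p))) v w))"
proof (intro ext)
  fix v w
  let ?A = "frechet_derivative f (at (fst p))"
  have "((\<lambda>q. \<i> * complex_of_real (f (fst q) \<bullet> snd w)) has_derivative
      (\<lambda>v. \<i> * complex_of_real (?A (fst v) \<bullet> snd w))) (at (dlift p))" for w :: "'a tangent"
  proof -
    have "(f has_derivative ?A) (at (fst (dlift p)))"
      using local_lift_has_derivative[OF lift p] by (simp add: dlift_def)
    then have "((\<lambda>q. f (fst q)) has_derivative (\<lambda>v. ?A (fst v))) (at (dlift p))"
      by (rule has_derivative_compose[OF has_derivative_fst[OF has_derivative_ident]])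
    then show ?thesis
      by (intro has_derivative_mult_right has_derivative_of_real has_derivative_inner_left)
  qed
  note D = frechet_derivative_at[OF this, symmetric]
  show "curvature (fourier_mukai B h) (U, f) p v w = \<i> * of_real (twisted_pairing ?A v w)"
    by (simp add: curvature_def ext_deriv_def fourier_mukai_conn_form D twisted_pairing_def
        algebra_simps)
qed

lemma fourier_mukai_type_11_iff:
  assumes "local_lift B h U f" "fst p \<in> U" "\<And>v. C (C v) = - v"
  shows "component02 C (curvature (fourier_mukai B h) (U, f) p) = (\<lambda>v w. 0) \<longleftrightarrow>
    (\<forall>v w. twisted_pairing (frechet_derivative f (at (fst p))) (C v) (C w) =
      twisted_pairing (frechet_derivative f (at (fst p))) v w)"
  unfolding fourier_mukai_curvature[OF assms(1,2)]
  using bilinear_twisted_pairing[OF local_lift_linear[OF assms(1,2)]] assms(3)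
  by (rule component02_imaginary_eq_0_iff)

lemma invariant_if_primitive_HYM_fourier_mukai:
  assumes HYM: "primitive_HYM C (fourier_mukai B h)" and C: "\<And>v. C (C v) = - v"
    and lift: "local_lift B h U f" "x \<in> U"
  shows "twisted_pairing (frechet_derivative f (at x)) (C v) (C w) =
    twisted_pairing (frechet_derivative f (at x)) v w"
proof -
  \<comment> \<open>The curvature is constant along the torus fibres, so any point over \<open>x\<close> will do.\<close>
  define p where "p = (x, undefined :: ('a + 'a) dual_torus)"
  have "(U, f) \<in> patches (fourier_mukai B h)" "p \<in> patch_dom (fourier_mukai B h) (U, f)"
    using lift by (auto simp: fourier_mukai_patches p_def)
  then have F: "component02 C (curvature (fourier_mukai B h) (U, f) p) = (\<lambda>v w. 0)"
    using HYM unfolding primitive_HYM_def by blast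
  have p: "fst p = x" by (simp add: p_def)
  then have "fst p \<in> U" using lift(2) by simp
  from fourier_mukai_type_11_iff[OF lift(1) this C, THEN iffD1, OF F]
  show ?thesis unfolding p by blast
qed

text \<open>
  The Hermitian Yang-Mills equation for \<open>L\<close> uses the type condition for a second structure \<open>M\<close>
  that anticommutes with \<open>L\<close>.
\<close>

lemma primitive_HYM_fourier_mukai:
  assumes inv: "\<And>U f x v w. local_lift B h U f \<Longrightarrow> x \<in> U \<Longrightarrow>
        twisted_pairing (frechet_derivative f (at x)) (L v) (L w) =
        twisted_pairing (frechet_derivative f (at x)) v w"
      "\<And>U f x v w. local_lift B h U f \<Longrightarrow> x \<in> U \<Longrightarrow>
        twisted_pairing (frechet_derivative f (at x)) (M v) (M w) =
        twisted_pairing (frechet_derivative f (at x)) v w"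
    and lin: "linear L" "linear M"
    and LL: "\<And>v. L (L v) = - v" and MM: "\<And>v. M (M v) = - v"
    and anti: "\<And>v. M (L v) = - L (M v)"
    and orth: "\<And>v w. L v \<bullet> L w = v \<bullet> w" "\<And>v w. M v \<bullet> M w = v \<bullet> w"
  shows "primitive_HYM L (fourier_mukai B h)"
  unfolding primitive_HYM_def
proof (intro ballI)
  fix i p assume "i \<in> patches (fourier_mukai B h)" "p \<in> patch_dom (fourier_mukai B h) i"
  then obtain U f where i: "i = (U, f)" and lift: "local_lift B h U f" and p: "fst p \<in> U"
    by (auto simp: fourier_mukai_patches)
  let ?G = "twisted_pairing (frechet_derivative f (at (fst p)))"
  have "bilinear ?G" using lift p by (intro bilinear_twisted_pairing local_lift_linear)
  then have "bilinear (\<lambda>v w. \<i> * complex_of_real (?G v w))"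
    by (simp add: bilinear_def linear_iff distrib_left scaleR_conv_of_real)
  then have "wedge 2 (2 * (2 * CARD('a) - 1)) (two_form (\<lambda>v w. \<i> * of_real (?G v w)))
      (wedge_power (two_form (\<lambda>v w. of_real (kform L v w))) (2 * CARD('a) - 1)) = (\<lambda>V. 0)"
    by (rule wedge_kform_power_eq_0[of _ L M]) (simp_all only: inv[OF lift p] lin LL MM anti orth)
  then show "component02 L (curvature (fourier_mukai B h) i p) = (\<lambda>v w. 0) \<and>
      wedge 2 (2 * (2 * CARD('a) - 1)) (two_form (curvature (fourier_mukai B h) i p))
        (wedge_power (two_form (\<lambda>v w. of_real (kform L v w))) (2 * CARD('a) - 1)) = (\<lambda>V. 0)"
    unfolding i using fourier_mukai_type_11_iff[OF lift p LL] inv[OF lift p]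
    by (simp only: fourier_mukai_curvature[OF lift p] simp_thms)
qed

lemma Sp_instanton_fourier_mukai_iff:
  fixes B :: "'n::finite base set"
  assumes h: "torus_smooth_on B h"
  shows "Sp_instanton (B \<times> UNIV) (fourier_mukai B h) \<longleftrightarrow>
    (\<forall>U f x. local_lift B h U f \<and> x \<in> U \<longrightarrow> (let G = twisted_pairing (frechet_derivative f (at x)) in
      (\<forall>v w. G (cxI v) (cxI w) = G v w) \<and> (\<forall>v w. G (cxJ v) (cxJ w) = G v w) \<and>
      (\<forall>v w. G (cxK v) (cxK w) = G v w)))" (is "_ \<longleftrightarrow> ?R")
proof
  assume "Sp_instanton (B \<times> UNIV) (fourier_mukai B h)"
  then have HYM: "primitive_HYM cxI (fourier_mukai B h)" "primitive_HYM cxJ (fourier_mukai B h)"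
    "primitive_HYM cxK (fourier_mukai B h)"
    by (simp_all only: Sp_instanton_def)
  show ?R
    unfolding Let_def
    using invariant_if_primitive_HYM_fourier_mukai[OF HYM(1) hyperkaehler_quaternions(1)]
      invariant_if_primitive_HYM_fourier_mukai[OF HYM(2) hyperkaehler_quaternions(2)]
      invariant_if_primitive_HYM_fourier_mukai[OF HYM(3) hyperkaehler_quaternions(3)]
    by blast
next
  assume R: ?R
  have inv:
    "twisted_pairing (frechet_derivative f (at x)) (cxI v) (cxI w) =
      twisted_pairing (frechet_derivative f (at x)) v w"
    "twisted_pairing (frechet_derivative f (at x)) (cxJ v) (cxJ w) =
      twisted_pairing (frechet_derivative f (at x)) v w"
    "twisted_pairing (frechet_derivative f (at x)) (cxK v) (cxK w) =
      twisted_pairing (frechet_derivative f (at x)) v w"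
    if "local_lift B h U f" "x \<in> U" for U f x v w
    using R that unfolding Let_def by blast+
  have "primitive_HYM cxI (fourier_mukai B h)"
    by (rule primitive_HYM_fourier_mukai[of B h cxI cxJ])
      (simp_all only: inv linear_cx hyperkaehler_quaternions hyperkaehler_anticommute
        hyperkaehler_orthogonal)
  moreover have "primitive_HYM cxJ (fourier_mukai B h)"
    by (rule primitive_HYM_fourier_mukai[of B h cxJ cxK])
      (simp_all only: inv linear_cx hyperkaehler_quaternions hyperkaehler_anticommute
        hyperkaehler_orthogonal)
  moreover have "primitive_HYM cxK (fourier_mukai B h)"
    by (rule primitive_HYM_fourier_mukai[of B h cxK cxI])
      (simp_all only: inv linear_cx hyperkaehler_quaternions hyperkaehler_anticommute
        hyperkaehler_orthogonal)
  ultimately show "Sp_instanton (B \<times> UNIV) (fourier_mukai B h)"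
    using hermitian_connection_fourier_mukai[OF h] by (simp only: Sp_instanton_def simp_thms)
qed

theorem theorem1p1:
  fixes B :: "(real ^ ('n::finite + 'n)) set"
    and h :: "real ^ ('n + 'n) \<Rightarrow> ('n + 'n) torus"
  assumes "open B"
    and "torus_smooth_on B h"
  shows "complex_lagrangian (B \<times> UNIV) (graph_on B h)
     \<longleftrightarrow> Sp_instanton (B \<times> UNIV) (fourier_mukai B h)"
proof -
  have "(let A = frechet_derivative f (at x) in
      (\<forall>p. \<exists>p'. cxI (p, A p) = (p', A p')) \<and>
      (\<forall>p p'. kform cxJ (p, A p) (p', A p') = 0) \<and>
      (\<forall>p p'. kform cxK (p, A p) (p', A p') = 0)) \<longleftrightarrow>
    (let G = twisted_pairing (frechet_derivative f (at x)) in
      (\<forall>v w. G (cxI v) (cxI w) = G v w) \<and> (\<forall>v w. G (cxJ v) (cxJ w) = G v w) \<and>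
      (\<forall>v w. G (cxK v) (cxK w) = G v w))"
    if "local_lift B h U f \<and> x \<in> U" for U f x
  proof -
    have "linear (frechet_derivative f (at x))" using that local_lift_linear by blast
    then show ?thesis
      by (simp only: Let_def twisted_pairing_cxI_iff twisted_pairing_cxJ_iff twisted_pairing_cxK_iff)
  qed
  then show ?thesis
    unfolding complex_lagrangian_graph_iff[OF assms(2)] Sp_instanton_fourier_mukai_iff[OF assms(2)]
    by (intro all_cong1 imp_cong refl)
qed

end
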